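(* Let $(P,\leq)$ be a finite preordered set with corresponding category $\mathbf{P}$ and let $R$ be a unital ring. Let $U = \bigoplus_{a \in P}R[U_a]$. Then $\mathrm{Hom}(U,-): \mathbf{Mod}_R^{\mathbf{P}} \to \mathbf{Mod}_{\mathrm{End}(U)}$ is an equivalence of categories.
   Context: $\mathbf{Mod}_R$ denotes the category of right modules over a unital ring $R$, and $\mathbf{Mod}_R^{\mathbf{P}}$ is the category of functors $\mathbf{P}\to\mathbf{Mod}_R$ (right persistence modules) with natural transformations. For $a\in P$, $U_a=\{b\in P: a\le b\}$, and $R[U_a]:\mathbf{P}\to\mathbf{Mod}_R$ is the functor equal to $R$ at points of $U_a$ and $0$ elsewhere, with all maps between points of $U_a$ equal to the identity. $\mathrm{Hom}(U,M)$ is the set of natural transformations, a right $\mathrm{End}(U)$-module by precomposition. *)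

theory Defs
  imports "HOL-Algebra.Module"
begin

unbundle cardinal_syntax

section \<open>Categories\<close>

text \<open>
  Composition is in the usual order: \<open>Comp C x y z g f\<close> is \<open>g\<close> after \<open>f\<close>, for \<open>f\<close> from \<open>x\<close> to
  \<open>y\<close> and \<open>g\<close> from \<open>y\<close> to \<open>z\<close>.  The objects are arguments of \<open>Comp\<close> because the Hom-sets
  need not be disjoint.
\<close>

record ('o, 'a) cat =
  Obj :: "'o set"
  Hom :: "'o \<Rightarrow> 'o \<Rightarrow> 'a set"
  Comp :: "'o \<Rightarrow> 'o \<Rightarrow> 'o \<Rightarrow> 'a \<Rightarrow> 'a \<Rightarrow> 'a"
  Ide :: "'o \<Rightarrow> 'a"

locale category =
  fixes C :: "('o, 'a) cat"
  assumes Ide_Hom: "x \<in> Obj C \<Longrightarrow> Ide C x \<in> Hom C x x"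
    and Comp_Hom: "\<lbrakk>x \<in> Obj C; y \<in> Obj C; z \<in> Obj C; f \<in> Hom C x y; g \<in> Hom C y z\<rbrakk>
      \<Longrightarrow> Comp C x y z g f \<in> Hom C x z"
    and Comp_assoc: "\<lbrakk>w \<in> Obj C; x \<in> Obj C; y \<in> Obj C; z \<in> Obj C;
        f \<in> Hom C w x; g \<in> Hom C x y; h \<in> Hom C y z\<rbrakk>
      \<Longrightarrow> Comp C w y z h (Comp C w x y g f) = Comp C w x z (Comp C x y z h g) f"
    and Comp_Ide_right: "\<lbrakk>x \<in> Obj C; y \<in> Obj C; f \<in> Hom C x y\<rbrakk>
      \<Longrightarrow> Comp C x x y f (Ide C x) = f"
    and Comp_Ide_left: "\<lbrakk>x \<in> Obj C; y \<in> Obj C; f \<in> Hom C x y\<rbrakk>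
      \<Longrightarrow> Comp C x y y (Ide C y) f = f"

definition iso_in :: "('o, 'a) cat \<Rightarrow> 'o \<Rightarrow> 'o \<Rightarrow> 'a \<Rightarrow> bool" where
  "iso_in C x y f \<longleftrightarrow> f \<in> Hom C x y \<and>
     (\<exists>g \<in> Hom C y x. Comp C x y x g f = Ide C x \<and> Comp C y x y f g = Ide C y)"

record ('o, 'a, 'p, 'b) fctr =
  FObj :: "'o \<Rightarrow> 'p"
  FArr :: "'o \<Rightarrow> 'o \<Rightarrow> 'a \<Rightarrow> 'b"

locale cat_functor = C: category C + D: category D
  for C :: "('o, 'a) cat" and D :: "('p, 'b) cat" +
  fixes F :: "('o, 'a, 'p, 'b) fctr"
  assumes FObj_Obj: "x \<in> Obj C \<Longrightarrow> FObj F x \<in> Obj D"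
    and FArr_Hom: "\<lbrakk>x \<in> Obj C; y \<in> Obj C; f \<in> Hom C x y\<rbrakk>
      \<Longrightarrow> FArr F x y f \<in> Hom D (FObj F x) (FObj F y)"
    and FArr_Ide: "x \<in> Obj C \<Longrightarrow> FArr F x x (Ide C x) = Ide D (FObj F x)"
    and FArr_Comp: "\<lbrakk>x \<in> Obj C; y \<in> Obj C; z \<in> Obj C; f \<in> Hom C x y; g \<in> Hom C y z\<rbrakk>
      \<Longrightarrow> FArr F x z (Comp C x y z g f) =
          Comp D (FObj F x) (FObj F y) (FObj F z) (FArr F y z g) (FArr F x y f)"

definition id_functor :: "('o, 'a, 'o, 'a) fctr" where
  "id_functor = \<lparr>FObj = (\<lambda>x. x), FArr = (\<lambda>x y f. f)\<rparr>"

definition comp_functor ::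
  "('p, 'b, 'q, 'c) fctr \<Rightarrow> ('o, 'a, 'p, 'b) fctr \<Rightarrow> ('o, 'a, 'q, 'c) fctr" where
  "comp_functor G F = \<lparr>FObj = (\<lambda>x. FObj G (FObj F x)),
     FArr = (\<lambda>x y f. FArr G (FObj F x) (FObj F y) (FArr F x y f))\<rparr>"

text \<open>
  Families are extensional, so that natural transformations are equal as soon as their
  components at the objects of \<open>C\<close> are.
\<close>

definition nat_trans ::
  "('o, 'a) cat \<Rightarrow> ('p, 'b) cat \<Rightarrow> ('o, 'a, 'p, 'b) fctr \<Rightarrow> ('o, 'a, 'p, 'b) fctr \<Rightarrow> ('o \<Rightarrow> 'b) set"
  where
  "nat_trans C D F G = {\<eta> \<in> \<Pi>\<^sub>E x\<in>Obj C. Hom D (FObj F x) (FObj G x).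
     \<forall>x\<in>Obj C. \<forall>y\<in>Obj C. \<forall>f\<in>Hom C x y.
       Comp D (FObj F x) (FObj F y) (FObj G y) (\<eta> y) (FArr F x y f) =
       Comp D (FObj F x) (FObj G x) (FObj G y) (FArr G x y f) (\<eta> x)}"

definition nat_isomorphic ::
  "('o, 'a) cat \<Rightarrow> ('p, 'b) cat \<Rightarrow> ('o, 'a, 'p, 'b) fctr \<Rightarrow> ('o, 'a, 'p, 'b) fctr \<Rightarrow> bool"
  where
  "nat_isomorphic C D F G \<longleftrightarrow>
     (\<exists>\<eta> \<in> nat_trans C D F G. \<forall>x\<in>Obj C. iso_in D (FObj F x) (FObj G x) (\<eta> x))"

definition equivalence_of_categories ::
  "('o, 'a) cat \<Rightarrow> ('p, 'b) cat \<Rightarrow> ('o, 'a, 'p, 'b) fctr \<Rightarrow> bool" where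
  "equivalence_of_categories C D F \<longleftrightarrow> cat_functor C D F \<and>
     (\<exists>G. cat_functor D C G \<and>
          nat_isomorphic C C id_functor (comp_functor G F) \<and>
          nat_isomorphic D D (comp_functor F G) id_functor)"

text \<open>
  Functors that agree on \<open>C\<close> but differ outside of it count as different objects of the functor
  category; they are isomorphic there.
\<close>

definition functor_cat ::
  "('o, 'a) cat \<Rightarrow> ('p, 'b) cat \<Rightarrow> (('o, 'a, 'p, 'b) fctr, 'o \<Rightarrow> 'b) cat" where
  "functor_cat C D = \<lparr>
     Obj = {F. cat_functor C D F},
     Hom = (\<lambda>F G. nat_trans C D F G),
     Comp = (\<lambda>F G H \<beta> \<alpha>. \<lambda>x\<in>Obj C. Comp D (FObj F x) (FObj G x) (FObj H x) (\<beta> x) (\<alpha> x)),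
     Ide = (\<lambda>F. \<lambda>x\<in>Obj C. Ide D (FObj F x))\<rparr>"

definition preorder_cat :: "'p set \<Rightarrow> 'p rel \<Rightarrow> ('p, unit) cat" where
  "preorder_cat P leq = \<lparr>
     Obj = P,
     Hom = (\<lambda>a b. if (a, b) \<in> leq then {()} else {}),
     Comp = (\<lambda>_ _ _ _ _. ()),
     Ide = (\<lambda>_. ())\<rparr>"


section \<open>Right modules\<close>

text \<open>
  The record \<^type>\<open>ring\<close> supplies the additive structure of a module; its fields \<open>mult\<close> and
  \<open>one\<close> play no role.  The library's locale \<^locale>\<open>module\<close> is about (left) modules over
  commutative rings only.
\<close>

record ('r, 'm) rmodule = "'m ring" +
  ract :: "'m \<Rightarrow> 'r \<Rightarrow> 'm" (infixl \<open>\<star>\<index>\<close> 70)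

locale right_module = R: ring R + M: abelian_group M
  for R :: "('r, 'x) ring_scheme" (structure) and M :: "('r, 'm) rmodule" (structure) +
  assumes ract_closed: "\<lbrakk>x \<in> carrier M; r \<in> carrier R\<rbrakk> \<Longrightarrow> x \<star>\<^bsub>M\<^esub> r \<in> carrier M"
    and ract_add_left: "\<lbrakk>x \<in> carrier M; y \<in> carrier M; r \<in> carrier R\<rbrakk>
      \<Longrightarrow> (x \<oplus>\<^bsub>M\<^esub> y) \<star>\<^bsub>M\<^esub> r = x \<star>\<^bsub>M\<^esub> r \<oplus>\<^bsub>M\<^esub> y \<star>\<^bsub>M\<^esub> r"
    and ract_add_right: "\<lbrakk>x \<in> carrier M; r \<in> carrier R; s \<in> carrier R\<rbrakk>
      \<Longrightarrow> x \<star>\<^bsub>M\<^esub> (r \<oplus>\<^bsub>R\<^esub> s) = x \<star>\<^bsub>M\<^esub> r \<oplus>\<^bsub>M\<^esub> x \<star>\<^bsub>M\<^esub> s"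
    and ract_mult: "\<lbrakk>x \<in> carrier M; r \<in> carrier R; s \<in> carrier R\<rbrakk>
      \<Longrightarrow> x \<star>\<^bsub>M\<^esub> (r \<otimes>\<^bsub>R\<^esub> s) = (x \<star>\<^bsub>M\<^esub> r) \<star>\<^bsub>M\<^esub> s"
    and ract_one: "x \<in> carrier M \<Longrightarrow> x \<star>\<^bsub>M\<^esub> \<one>\<^bsub>R\<^esub> = x"

definition rmod_hom ::
  "('r, 'x) ring_scheme \<Rightarrow> ('r, 'm) rmodule \<Rightarrow> ('r, 'n) rmodule \<Rightarrow> ('m \<Rightarrow> 'n) set" where
  "rmod_hom R M N = {f \<in> carrier M \<rightarrow>\<^sub>E carrier N.
     (\<forall>x\<in>carrier M. \<forall>y\<in>carrier M. f (x \<oplus>\<^bsub>M\<^esub> y) = f x \<oplus>\<^bsub>N\<^esub> f y) \<and>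
     (\<forall>x\<in>carrier M. \<forall>r\<in>carrier R. f (x \<star>\<^bsub>M\<^esub> r) = f x \<star>\<^bsub>N\<^esub> r)}"

text \<open>
  The category of right \<open>R\<close>-modules.  As there is no set of all modules, it is formed, as usual,
  from the small ones; small means of cardinality less than a given infinite cardinal \<open>\<kappa>\<close>
  (for instance an inaccessible one, which yields the modules in a Grothendieck universe).
  The elements of the modules are drawn from the type \<^typ>\<open>'m\<close>; if \<open>\<kappa>\<close> has at most
  the cardinality of \<^typ>\<open>'m\<close>, every small module has an isomorphic copy among the objects.
\<close>

definition Mod :: "'k rel \<Rightarrow> ('r, 'x) ring_scheme \<Rightarrow> (('r, 'm) rmodule, 'm \<Rightarrow> 'm) cat" where
  "Mod \<kappa> R = \<lparr>
     Obj = {M. right_module R M \<and> |carrier M| <o \<kappa>},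
     Hom = (\<lambda>M N. rmod_hom R M N),
     Comp = (\<lambda>L M N g f. compose (carrier L) g f),
     Ide = (\<lambda>M. \<lambda>x\<in>carrier M. x)\<rparr>"

definition regular_rmodule :: "('r, 'x) ring_scheme \<Rightarrow> ('r, 'r) rmodule" where
  "regular_rmodule R = \<lparr>carrier = carrier R, mult = undefined, one = undefined,
     zero = \<zero>\<^bsub>R\<^esub>, add = (\<oplus>\<^bsub>R\<^esub>), ract = (\<otimes>\<^bsub>R\<^esub>)\<rparr>"

definition zero_rmodule :: "('r, 'x) ring_scheme \<Rightarrow> ('r, 'r) rmodule" where
  "zero_rmodule R = (regular_rmodule R)\<lparr>carrier := {\<zero>\<^bsub>R\<^esub>}\<rparr>"

definition rmod_dsum :: "'i set \<Rightarrow> ('i \<Rightarrow> ('r, 'm) rmodule) \<Rightarrow> ('r, 'i \<Rightarrow> 'm) rmodule" where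
  "rmod_dsum I M = \<lparr>
     carrier = {x \<in> \<Pi>\<^sub>E i\<in>I. carrier (M i). finite {i\<in>I. x i \<noteq> \<zero>\<^bsub>M i\<^esub>}},
     mult = undefined, one = undefined,
     zero = (\<lambda>i\<in>I. \<zero>\<^bsub>M i\<^esub>),
     add = (\<lambda>x y. \<lambda>i\<in>I. x i \<oplus>\<^bsub>M i\<^esub> y i),
     ract = (\<lambda>x r. \<lambda>i\<in>I. x i \<star>\<^bsub>M i\<^esub> r)\<rparr>"


section \<open>Persistence modules\<close>

type_synonym ('p, 'r, 'm) pmodule = "('p, unit, ('r, 'm) rmodule, 'm \<Rightarrow> 'm) fctr"

abbreviation PMod ::
  "'k rel \<Rightarrow> 'p set \<Rightarrow> 'p rel \<Rightarrow> ('r, 'x) ring_scheme \<Rightarrow>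
   (('p, 'r, 'm) pmodule, 'p \<Rightarrow> 'm \<Rightarrow> 'm) cat" where
  "PMod \<kappa> P leq R \<equiv> functor_cat (preorder_cat P leq) (Mod \<kappa> R)"

definition up_set :: "'p set \<Rightarrow> 'p rel \<Rightarrow> 'p \<Rightarrow> 'p set" where
  "up_set P leq a = {b \<in> P. (a, b) \<in> leq}"

text \<open>The persistence module \<open>R[S]\<close>.\<close>

definition indicator_pmod :: "('r, 'x) ring_scheme \<Rightarrow> 'p set \<Rightarrow> ('p, 'r, 'r) pmodule" where
  "indicator_pmod R S = \<lparr>
     FObj = (\<lambda>b. if b \<in> S then regular_rmodule R else zero_rmodule R),
     FArr = (\<lambda>b c _. if b \<in> S \<and> c \<in> S then (\<lambda>x\<in>carrier R. x)
                      else (\<lambda>x\<in>carrier (if b \<in> S then regular_rmodule R else zero_rmodule R). \<zero>\<^bsub>R\<^esub>))\<rparr>"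

definition pmod_dsum ::
  "'i set \<Rightarrow> ('i \<Rightarrow> ('p, 'r, 'm) pmodule) \<Rightarrow> ('p, 'r, 'i \<Rightarrow> 'm) pmodule" where
  "pmod_dsum I F = \<lparr>
     FObj = (\<lambda>b. rmod_dsum I (\<lambda>i. FObj (F i) b)),
     FArr = (\<lambda>b c u. \<lambda>x\<in>carrier (rmod_dsum I (\<lambda>i. FObj (F i) b)).
               \<lambda>i\<in>I. FArr (F i) b c u (x i))\<rparr>"

text \<open>
  \<open>Hom(U, M)\<close> as the set of natural transformations.  This is the Hom-set of the category of
  persistence modules (see \<open>pmod_hom_eq_Hom\<close> below), except that the elements of \<open>U\<close> and of
  \<open>M\<close> may be of different types.
\<close>

definition pmod_hom ::
  "'p set \<Rightarrow> 'p rel \<Rightarrow> ('r, 'x) ring_scheme \<Rightarrow> ('p, 'r, 'u) pmodule \<Rightarrow> ('p, 'r, 'm) pmodule \<Rightarrow>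
   ('p \<Rightarrow> 'u \<Rightarrow> 'm) set" where
  "pmod_hom P leq R U M = {\<eta> \<in> \<Pi>\<^sub>E b\<in>P. rmod_hom R (FObj U b) (FObj M b).
     \<forall>b\<in>P. \<forall>c\<in>P. (b, c) \<in> leq \<longrightarrow>
       compose (carrier (FObj U b)) (\<eta> c) (FArr U b c ()) =
       compose (carrier (FObj U b)) (FArr M b c ()) (\<eta> b)}"

definition pmod_comp ::
  "'p set \<Rightarrow> ('p, 'r, 'u) pmodule \<Rightarrow> ('p \<Rightarrow> 'm \<Rightarrow> 'n) \<Rightarrow> ('p \<Rightarrow> 'u \<Rightarrow> 'm) \<Rightarrow> 'p \<Rightarrow> 'u \<Rightarrow> 'n" where
  "pmod_comp P U \<beta> \<alpha> = (\<lambda>b\<in>P. compose (carrier (FObj U b)) (\<beta> b) (\<alpha> b))"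

lemma pmod_hom_eq_Hom: "pmod_hom P leq R U M = Hom (PMod \<kappa> P leq R) U M"
  by (auto simp: pmod_hom_def functor_cat_def nat_trans_def preorder_cat_def Mod_def)

lemma pmod_comp_eq_Comp: "pmod_comp P U \<beta> \<alpha> = Comp (PMod \<kappa> P leq R) U M N \<beta> \<alpha>"
  by (simp add: pmod_comp_def functor_cat_def preorder_cat_def Mod_def)

definition End_ring ::
  "'p set \<Rightarrow> 'p rel \<Rightarrow> ('r, 'x) ring_scheme \<Rightarrow> ('p, 'r, 'u) pmodule \<Rightarrow> ('p \<Rightarrow> 'u \<Rightarrow> 'u) ring" where
  "End_ring P leq R U = \<lparr>
     carrier = pmod_hom P leq R U U,
     mult = (\<lambda>\<beta> \<alpha>. pmod_comp P U \<beta> \<alpha>),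
     one = (\<lambda>b\<in>P. \<lambda>x\<in>carrier (FObj U b). x),
     zero = (\<lambda>b\<in>P. \<lambda>x\<in>carrier (FObj U b). \<zero>\<^bsub>FObj U b\<^esub>),
     add = (\<lambda>\<alpha> \<beta>. \<lambda>b\<in>P. \<lambda>x\<in>carrier (FObj U b). \<alpha> b x \<oplus>\<^bsub>FObj U b\<^esub> \<beta> b x)\<rparr>"

definition Hom_rmodule ::
  "'p set \<Rightarrow> 'p rel \<Rightarrow> ('r, 'x) ring_scheme \<Rightarrow> ('p, 'r, 'u) pmodule \<Rightarrow> ('p, 'r, 'm) pmodule \<Rightarrow>
   ('p \<Rightarrow> 'u \<Rightarrow> 'u, 'p \<Rightarrow> 'u \<Rightarrow> 'm) rmodule" where
  "Hom_rmodule P leq R U M = \<lparr>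
     carrier = pmod_hom P leq R U M,
     mult = undefined, one = undefined,
     zero = (\<lambda>b\<in>P. \<lambda>x\<in>carrier (FObj U b). \<zero>\<^bsub>FObj M b\<^esub>),
     add = (\<lambda>\<eta> \<theta>. \<lambda>b\<in>P. \<lambda>x\<in>carrier (FObj U b). \<eta> b x \<oplus>\<^bsub>FObj M b\<^esub> \<theta> b x),
     ract = (\<lambda>\<eta> \<alpha>. pmod_comp P U \<eta> \<alpha>)\<rparr>"

definition Hom_functor ::
  "'p set \<Rightarrow> 'p rel \<Rightarrow> ('r, 'x) ring_scheme \<Rightarrow> ('p, 'r, 'u) pmodule \<Rightarrow>
   (('p, 'r, 'm) pmodule, 'p \<Rightarrow> 'm \<Rightarrow> 'm,
    ('p \<Rightarrow> 'u \<Rightarrow> 'u, 'p \<Rightarrow> 'u \<Rightarrow> 'm) rmodule, ('p \<Rightarrow> 'u \<Rightarrow> 'm) \<Rightarrow> ('p \<Rightarrow> 'u \<Rightarrow> 'm)) fctr" where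
  "Hom_functor P leq R U = \<lparr>
     FObj = (\<lambda>M. Hom_rmodule P leq R U M),
     FArr = (\<lambda>M N \<phi>. \<lambda>\<eta>\<in>pmod_hom P leq R U M. pmod_comp P U \<phi> \<eta>)\<rparr>"

end

theory Submission
  imports Defs
begin

text \<open>
  Evaluation at the unit vector \<open>\<delta> a\<close> of \<open>R[U\<^sub>a] a = R\<close> is the Yoneda bijection from
  \<open>Hom(R[U\<^sub>a], M)\<close> to \<open>M a\<close>, whose inverse sends \<open>m\<close> to \<open>yoneda M a m\<close>.  For \<open>M = U\<close> this gives
  endomorphisms of \<open>U\<close>, and the identity \<open>\<eta> \<circ> yoneda U a x = yoneda M a (\<eta> a x)\<close>, valid for all
  \<open>\<eta>\<close> from \<open>U\<close> to \<open>M\<close>, carries the whole argument: together with right \<open>End(U)\<close>-linearity it shows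
  that a map \<open>h\<close> from \<open>Hom(U, M)\<close> to \<open>Hom(U, N)\<close> is composition with
  \<open>\<phi> a m = h (yoneda M a m) a (\<delta> a)\<close>.  The endomorphisms \<open>\<epsilon> a = yoneda U a (\<delta> a)\<close> are orthogonal
  idempotents with sum \<open>1\<close>, since \<open>P\<close> is finite; hence a right \<open>End(U)\<close>-module \<open>N\<close> is the direct sum of
  the \<open>N \<epsilon> a\<close>.  The latter form a persistence module, in which \<open>r \<in> R\<close> acts on \<open>N \<epsilon> a\<close> through
  \<open>yoneda U a (\<delta> a r)\<close> and \<open>a \<le> b\<close> acts through \<open>yoneda U b (\<delta> a)\<close>, and \<open>N\<close> is isomorphic to its
  \<open>Hom\<close>-module.
\<close>

section \<open>Equivalences from fully faithful, essentially surjective functors\<close>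

lemma iso_inI:
  "\<lbrakk>f \<in> Hom C x y; g \<in> Hom C y x; Comp C x y x g f = Ide C x; Comp C y x y f g = Ide C y\<rbrakk>
   \<Longrightarrow> iso_in C x y f"
  by (auto simp: iso_in_def)

lemma iso_in_sym: "iso_in C x y f \<Longrightarrow> \<exists>g. iso_in C y x g"
  by (auto simp: iso_in_def)

text \<open>Choice gives every object \<open>z\<close> of \<open>D\<close> an object
  \<open>G0 z\<close> of \<open>C\<close> and an isomorphism \<open>e z\<close> from
  \<open>F (G0 z)\<close> to \<open>z\<close>. Conjugating arrows of \<open>D\<close> with these
  isomorphisms and lifting the result through \<open>F\<close> defines the quasi-inverse.
  Faithfulness reduces each equation in \<open>C\<close> to its image in \<open>D\<close>.\<close>

lemma equivalence_of_categoriesI: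
  fixes C :: "('o, 'a) cat" and D :: "('p, 'b) cat"
  assumes F: "cat_functor C D F"
    and faithful: "\<And>x y f f'. \<lbrakk>x \<in> Obj C; y \<in> Obj C; f \<in> Hom C x y; f' \<in> Hom C x y;
        FArr F x y f = FArr F x y f'\<rbrakk> \<Longrightarrow> f = f'"
    and full: "\<And>x y g. \<lbrakk>x \<in> Obj C; y \<in> Obj C; g \<in> Hom D (FObj F x) (FObj F y)\<rbrakk>
        \<Longrightarrow> \<exists>f \<in> Hom C x y. FArr F x y f = g"
    and ess_surj: "\<And>z. z \<in> Obj D \<Longrightarrow> \<exists>x \<in> Obj C. \<exists>e. iso_in D (FObj F x) z e"
  shows "equivalence_of_categories C D F"
proof -
  interpret F: cat_functor C D F by (rule F)
  \<comment> \<open>The object and the two mutually inverse arrows are packed into one triple, so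
    that a single choice function supplies all three coherently.\<close>
  have "\<exists>xee'. fst xee' \<in> Obj C \<and> fst (snd xee') \<in> Hom D (FObj F (fst xee')) z
      \<and> snd (snd xee') \<in> Hom D z (FObj F (fst xee'))
      \<and> Comp D (FObj F (fst xee')) z (FObj F (fst xee')) (snd (snd xee')) (fst (snd xee'))
        = Ide D (FObj F (fst xee'))
      \<and> Comp D z (FObj F (fst xee')) z (fst (snd xee')) (snd (snd xee')) = Ide D z"
    if "z \<in> Obj D" for z
    using ess_surj[OF that] unfolding iso_in_def by fastforce
  then obtain k where k: "\<And>z. z \<in> Obj D \<Longrightarrow> fst (k z) \<in> Obj C \<and>
      fst (snd (k z)) \<in> Hom D (FObj F (fst (k z))) z
      \<and> snd (snd (k z)) \<in> Hom D z (FObj F (fst (k z)))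
      \<and> Comp D (FObj F (fst (k z))) z (FObj F (fst (k z))) (snd (snd (k z))) (fst (snd (k z)))
        = Ide D (FObj F (fst (k z)))
      \<and> Comp D z (FObj F (fst (k z))) z (fst (snd (k z))) (snd (snd (k z))) = Ide D z"
    by metis
  define G0 where "G0 z = fst (k z)" for z
  define e where "e z = fst (snd (k z))" for z
  define e' where "e' z = snd (snd (k z))" for z
  let ?FG = "\<lambda>z. FObj F (G0 z)"
  have G0: "G0 z \<in> Obj C" and FG0: "?FG z \<in> Obj D"
    and e: "e z \<in> Hom D (?FG z) z" and e': "e' z \<in> Hom D z (?FG z)"
    and e'e: "Comp D (?FG z) z (?FG z) (e' z) (e z) = Ide D (?FG z)"
    and ee': "Comp D z (?FG z) z (e z) (e' z) = Ide D z" if "z \<in> Obj D" for z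
    using k[OF that] F.FObj_Obj by (auto simp: G0_def e_def e'_def)
  define lift where "lift x y g = (SOME f. f \<in> Hom C x y \<and> FArr F x y f = g)" for x y g
  have lift: "lift x y g \<in> Hom C x y" "FArr F x y (lift x y g) = g"
    if "x \<in> Obj C" "y \<in> Obj C" "g \<in> Hom D (FObj F x) (FObj F y)" for x y g
    using someI_ex[of "\<lambda>f. f \<in> Hom C x y \<and> FArr F x y f = g"] full[OF that]
    by (auto simp: lift_def)
  \<comment> \<open>The arrow \<open>g\<close> conjugated by the chosen isomorphisms:
    \<open>e' w\<close> after \<open>g\<close> after \<open>e z\<close>. Its lift will be the value
    of \<open>G\<close> at \<open>g\<close>.\<close>
  define conj where
    "conj z w g = Comp D (?FG z) z (?FG w) (Comp D z w (?FG w) (e' w) g) (e z)" for z w g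
  have conj_Hom: "conj z w g \<in> Hom D (?FG z) (?FG w)"
    if "z \<in> Obj D" "w \<in> Obj D" "g \<in> Hom D z w" for z w g
    unfolding conj_def by (intro F.D.Comp_Hom FG0 e e' that)
  \<comment> \<open>This is the naturality square of \<open>e\<close>, which becomes the counit;
    \<open>conj_right\<close> is that of \<open>e'\<close>, from which the unit is lifted.\<close>
  have conj_left: "Comp D (?FG z) (?FG w) w (e w) (conj z w g) = Comp D (?FG z) z w g (e z)"
    if zw: "z \<in> Obj D" "w \<in> Obj D" "g \<in> Hom D z w" for z w g
  proof -
    have "Comp D (?FG z) (?FG w) w (e w) (conj z w g) =
        Comp D (?FG z) z w (Comp D z (?FG w) w (e w) (Comp D z w (?FG w) (e' w) g)) (e z)"
      unfolding conj_def by (intro F.D.Comp_assoc F.D.Comp_Hom FG0 e e' zw)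
    also have "Comp D z (?FG w) w (e w) (Comp D z w (?FG w) (e' w) g) =
        Comp D z w w (Comp D w (?FG w) w (e w) (e' w)) g"
      by (intro F.D.Comp_assoc F.D.Comp_Hom FG0 e e' zw)
    finally show ?thesis using zw by (simp add: ee' F.D.Comp_Ide_left)
  qed
  have conj_right: "Comp D z (?FG z) (?FG w) (conj z w g) (e' z) = Comp D z w (?FG w) (e' w) g"
    if zw: "z \<in> Obj D" "w \<in> Obj D" "g \<in> Hom D z w" for z w g
  proof -
    have "Comp D z (?FG z) (?FG w) (conj z w g) (e' z) =
        Comp D z z (?FG w) (Comp D z w (?FG w) (e' w) g) (Comp D z (?FG z) z (e z) (e' z))"
      unfolding conj_def by (intro F.D.Comp_assoc[symmetric] F.D.Comp_Hom FG0 e e' zw)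
    then show ?thesis using zw by (simp add: ee' F.D.Comp_Ide_right F.D.Comp_Hom FG0 e')
  qed
  define G where
    "G = \<lparr>FObj = G0, FArr = (\<lambda>z w g. lift (G0 z) (G0 w) (conj z w g))\<rparr>"
  have GO[simp]: "FObj G z = G0 z" for z by (simp add: G_def)
  have GA: "FArr G z w g \<in> Hom C (G0 z) (G0 w)" "FArr F (G0 z) (G0 w) (FArr G z w g) = conj z w g"
    if "z \<in> Obj D" "w \<in> Obj D" "g \<in> Hom D z w" for z w g
    using lift[OF G0 G0 conj_Hom] that by (auto simp: G_def)
  have G: "cat_functor D C G"
  proof (intro cat_functor.intro cat_functor_axioms.intro F.D.category_axioms F.C.category_axioms)
    fix x assume x: "x \<in> Obj D"
    have "FArr F (G0 x) (G0 x) (FArr G x x (Ide D x)) = FArr F (G0 x) (G0 x) (Ide C (G0 x))"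
      using x by (simp add: GA F.D.Ide_Hom conj_def F.FArr_Ide G0 F.D.Comp_Ide_right e' FG0 e'e)
    then show "FArr G x x (Ide D x) = Ide C (FObj G x)"
      using x by (intro faithful[of "G0 x" "G0 x"]) (auto intro: G0 GA F.C.Ide_Hom F.D.Ide_Hom)
  next
    fix x y z f g assume h: "x \<in> Obj D" "y \<in> Obj D" "z \<in> Obj D" "f \<in> Hom D x y" "g \<in> Hom D y z"
    have gf: "Comp D x y z g f \<in> Hom D x z" by (intro F.D.Comp_Hom h)
    \<comment> \<open>The inner pair \<open>e y\<close>, \<open>e' y\<close> cancels. With
      \<open>conj_right\<close> doing the cancellation, only reassociation remains.\<close>
    have "Comp D (?FG x) (?FG y) (?FG z) (conj y z g) (conj x y f) =
       Comp D (?FG x) x (?FG z) (Comp D x (?FG y) (?FG z) (conj y z g) (Comp D x y (?FG y) (e' y) f)) (e x)"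
      unfolding conj_def[of x] by (intro F.D.Comp_assoc F.D.Comp_Hom conj_Hom FG0 e e' h)
    also have "Comp D x (?FG y) (?FG z) (conj y z g) (Comp D x y (?FG y) (e' y) f) =
       Comp D x y (?FG z) (Comp D y (?FG y) (?FG z) (conj y z g) (e' y)) f"
      by (intro F.D.Comp_assoc F.D.Comp_Hom conj_Hom FG0 e e' h)
    also have "\<dots> = Comp D x y (?FG z) (Comp D y z (?FG z) (e' z) g) f"
      using h by (simp add: conj_right)
    also have "\<dots> = Comp D x z (?FG z) (e' z) (Comp D x y z g f)"
      by (intro F.D.Comp_assoc[symmetric] FG0 e' h)
    finally have "Comp D (?FG x) (?FG y) (?FG z) (conj y z g) (conj x y f) = conj x z (Comp D x y z g f)"
      by (simp add: conj_def)
    then show "FArr G x z (Comp D x y z g f) =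
        Comp C (FObj G x) (FObj G y) (FObj G z) (FArr G y z g) (FArr G x y f)"
      using h gf
      by (intro faithful[of "G0 x" "G0 z"]) (auto intro!: G0 GA F.C.Comp_Hom simp: GA F.FArr_Comp G0)
  qed (auto intro: G0 GA)
  \<comment> \<open>The unit at \<open>x\<close> is the lift of \<open>e'\<close> at
    \<open>F x\<close>; its inverse is the lift of \<open>e\<close> at \<open>F x\<close>.\<close>
  let ?\<eta> = "\<lambda>x\<in>Obj C. lift x (G0 (FObj F x)) (e' (FObj F x))"
  have eta: "lift x (G0 (FObj F x)) (e' (FObj F x)) \<in> Hom C x (G0 (FObj F x))"
    "FArr F x (G0 (FObj F x)) (lift x (G0 (FObj F x)) (e' (FObj F x))) = e' (FObj F x)"
    if "x \<in> Obj C" for x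
    using lift[OF that G0 e'] F.FObj_Obj that by auto
  have eta': "lift (G0 (FObj F x)) x (e (FObj F x)) \<in> Hom C (G0 (FObj F x)) x"
    "FArr F (G0 (FObj F x)) x (lift (G0 (FObj F x)) x (e (FObj F x))) = e (FObj F x)"
    if "x \<in> Obj C" for x
    using lift[OF G0 that e] F.FObj_Obj that by auto
  have "nat_isomorphic C C id_functor (comp_functor G F)"
    unfolding nat_isomorphic_def
  proof (intro bexI ballI)
    fix x assume x: "x \<in> Obj C"
    let ?y = "G0 (FObj F x)"
    have y: "?y \<in> Obj C" using x F.FObj_Obj G0 by simp
    have "iso_in C x ?y (lift x ?y (e' (FObj F x)))"
    proof (rule iso_inI[where g = "lift ?y x (e (FObj F x))"])
      show "Comp C x ?y x (lift ?y x (e (FObj F x))) (lift x ?y (e' (FObj F x))) = Ide C x"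
        using x by (intro faithful[OF x x])
          (auto simp: F.FArr_Comp F.FArr_Ide eta eta' G0 F.FObj_Obj ee'
             intro!: F.C.Comp_Hom F.C.Ide_Hom y eta eta')
      show "Comp C ?y x ?y (lift x ?y (e' (FObj F x))) (lift ?y x (e (FObj F x))) = Ide C ?y"
        using x by (intro faithful[OF y y])
          (auto simp: F.FArr_Comp F.FArr_Ide eta eta' G0 F.FObj_Obj e'e
             intro!: F.C.Comp_Hom F.C.Ide_Hom y eta eta')
    qed (use eta eta' x in auto)
    then show "iso_in C (FObj id_functor x) (FObj (comp_functor G F) x) (?\<eta> x)"
      using x by (simp add: id_functor_def comp_functor_def)
  next
    have nat: "Comp C x y (G0 (FObj F y)) (lift y (G0 (FObj F y)) (e' (FObj F y))) f =
      Comp C x (G0 (FObj F x)) (G0 (FObj F y)) (FArr G (FObj F x) (FObj F y) (FArr F x y f))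
        (lift x (G0 (FObj F x)) (e' (FObj F x)))"
      if "x \<in> Obj C" "y \<in> Obj C" "f \<in> Hom C x y" for x y f
      using that
      by (intro faithful[of x "G0 (FObj F y)"])
        (auto intro!: F.C.Comp_Hom G0 F.FObj_Obj eta GA F.FArr_Hom
           simp: F.FArr_Comp G0 F.FObj_Obj eta GA F.FArr_Hom conj_right)
    show "?\<eta> \<in> nat_trans C C id_functor (comp_functor G F)"
      using nat eta by (auto simp: nat_trans_def id_functor_def comp_functor_def)
  qed
  moreover have "nat_isomorphic D D (comp_functor F G) id_functor"
    unfolding nat_isomorphic_def
  proof (intro bexI ballI)
    fix z assume z: "z \<in> Obj D"
    have "iso_in D (?FG z) z (e z)"
      using z by (intro iso_inI[where g = "e' z"] e e' e'e ee')
    then show "iso_in D (FObj (comp_functor F G) z) (FObj id_functor z) ((\<lambda>z\<in>Obj D. e z) z)"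
      using z by (simp add: id_functor_def comp_functor_def)
  next
    show "(\<lambda>z\<in>Obj D. e z) \<in> nat_trans D D (comp_functor F G) id_functor"
      using e conj_left by (auto simp: nat_trans_def id_functor_def comp_functor_def GA)
  qed
  ultimately show ?thesis
    unfolding equivalence_of_categories_def using F G by blast
qed

section \<open>Functor categories\<close>

lemma category_functor_cat:
  assumes "category D"
  shows "category (functor_cat C D)"
proof -
  interpret D: category D by (rule assms)
  note defs = functor_cat_def nat_trans_def
  show ?thesis
  proof (unfold_locales, goal_cases)
    case (1 F)
    then interpret F: cat_functor C D F by (simp add: functor_cat_def)
    show ?case
      by (auto simp: defs D.Comp_Ide_left D.Comp_Ide_right F.FObj_Obj F.FArr_Hom intro!: D.Ide_Hom F.FObj_Obj)
  next
    case (2 F G H \<alpha> \<beta>)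
    interpret F: cat_functor C D F using 2 by (simp add: functor_cat_def)
    interpret G: cat_functor C D G using 2 by (simp add: functor_cat_def)
    interpret H: cat_functor C D H using 2 by (simp add: functor_cat_def)
    have a: "\<alpha> x \<in> Hom D (FObj F x) (FObj G x)" "\<beta> x \<in> Hom D (FObj G x) (FObj H x)" if "x \<in> Obj C" for x
      using 2 that by (auto simp: defs)
    \<comment> \<open>The naturality square of the composite is the square of
      \<open>\<alpha>\<close> pasted to that of \<open>\<beta>\<close>.\<close>
    have "Comp D (FObj F x) (FObj F y) (FObj H y) (Comp D (FObj F y) (FObj G y) (FObj H y) (\<beta> y) (\<alpha> y)) (FArr F x y f)
        = Comp D (FObj F x) (FObj H x) (FObj H y) (FArr H x y f) (Comp D (FObj F x) (FObj G x) (FObj H x) (\<beta> x) (\<alpha> x))"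
      if xy: "x \<in> Obj C" "y \<in> Obj C" "f \<in> Hom C x y" for x y f
    proof -
      note o = F.FObj_Obj G.FObj_Obj H.FObj_Obj F.FArr_Hom G.FArr_Hom H.FArr_Hom a xy
      have "Comp D (FObj F x) (FObj F y) (FObj H y) (Comp D (FObj F y) (FObj G y) (FObj H y) (\<beta> y) (\<alpha> y)) (FArr F x y f)
        = Comp D (FObj F x) (FObj G y) (FObj H y) (\<beta> y) (Comp D (FObj F x) (FObj F y) (FObj G y) (\<alpha> y) (FArr F x y f))"
        by (intro D.Comp_assoc[symmetric] o)
      also have "Comp D (FObj F x) (FObj F y) (FObj G y) (\<alpha> y) (FArr F x y f)
        = Comp D (FObj F x) (FObj G x) (FObj G y) (FArr G x y f) (\<alpha> x)"
        using 2 xy by (auto simp: defs)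
      also have "Comp D (FObj F x) (FObj G y) (FObj H y) (\<beta> y) \<dots>
        = Comp D (FObj F x) (FObj G x) (FObj H y) (Comp D (FObj G x) (FObj G y) (FObj H y) (\<beta> y) (FArr G x y f)) (\<alpha> x)"
        by (intro D.Comp_assoc o)
      also have "Comp D (FObj G x) (FObj G y) (FObj H y) (\<beta> y) (FArr G x y f)
        = Comp D (FObj G x) (FObj H x) (FObj H y) (FArr H x y f) (\<beta> x)"
        using 2 xy by (auto simp: defs)
      also have "Comp D (FObj F x) (FObj G x) (FObj H y) \<dots> (\<alpha> x)
        = Comp D (FObj F x) (FObj H x) (FObj H y) (FArr H x y f) (Comp D (FObj F x) (FObj G x) (FObj H x) (\<beta> x) (\<alpha> x))"
        by (intro D.Comp_assoc[symmetric] o)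
      finally show ?thesis .
    qed
    then show ?case
      using a by (auto simp: defs F.FObj_Obj G.FObj_Obj H.FObj_Obj intro!: D.Comp_Hom)
  next
    case (3 F G H K \<alpha> \<beta> \<gamma>)
    interpret F: cat_functor C D F using 3 by (simp add: functor_cat_def)
    interpret G: cat_functor C D G using 3 by (simp add: functor_cat_def)
    interpret H: cat_functor C D H using 3 by (simp add: functor_cat_def)
    interpret K: cat_functor C D K using 3 by (simp add: functor_cat_def)
    show ?case
      using 3 by (auto simp: defs F.FObj_Obj G.FObj_Obj H.FObj_Obj K.FObj_Obj
          intro!: restrict_ext D.Comp_assoc)
  next
    case (4 F G \<alpha>)
    interpret F: cat_functor C D F using 4 by (simp add: functor_cat_def)
    interpret G: cat_functor C D G using 4 by (simp add: functor_cat_def)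
    show ?case
      using 4 by (intro extensionalityI[where A = "Obj C"])
        (auto simp: defs F.FObj_Obj G.FObj_Obj PiE_iff D.Comp_Ide_right)
  next
    case (5 F G \<alpha>)
    interpret F: cat_functor C D F using 5 by (simp add: functor_cat_def)
    interpret G: cat_functor C D G using 5 by (simp add: functor_cat_def)
    show ?case
      using 5 by (intro extensionalityI[where A = "Obj C"])
        (auto simp: defs F.FObj_Obj G.FObj_Obj PiE_iff D.Comp_Ide_left)
  qed
qed

section \<open>Right modules and persistence modules\<close>

lemma rmod_homI:
  assumes "\<And>x. x \<in> carrier M \<Longrightarrow> f x \<in> carrier N"
    and "\<And>x. x \<notin> carrier M \<Longrightarrow> f x = undefined"
    and "\<And>x y. \<lbrakk>x \<in> carrier M; y \<in> carrier M\<rbrakk> \<Longrightarrow> f (x \<oplus>\<^bsub>M\<^esub> y) = f x \<oplus>\<^bsub>N\<^esub> f y"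
    and "\<And>x r. \<lbrakk>x \<in> carrier M; r \<in> carrier R\<rbrakk> \<Longrightarrow> f (x \<star>\<^bsub>M\<^esub> r) = f x \<star>\<^bsub>N\<^esub> r"
  shows "f \<in> rmod_hom R M N"
  using assms by (auto simp: rmod_hom_def)

lemma
  assumes "f \<in> rmod_hom R M N"
  shows rmod_hom_closed: "x \<in> carrier M \<Longrightarrow> f x \<in> carrier N"
    and rmod_hom_extensional: "f \<in> extensional (carrier M)"
    and rmod_hom_funcset: "f \<in> carrier M \<rightarrow> carrier N"
    and rmod_hom_add: "\<lbrakk>x \<in> carrier M; y \<in> carrier M\<rbrakk> \<Longrightarrow> f (x \<oplus>\<^bsub>M\<^esub> y) = f x \<oplus>\<^bsub>N\<^esub> f y"
    and rmod_hom_ract: "\<lbrakk>x \<in> carrier M; r \<in> carrier R\<rbrakk> \<Longrightarrow> f (x \<star>\<^bsub>M\<^esub> r) = f x \<star>\<^bsub>N\<^esub> r"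
  using assms by (auto simp: rmod_hom_def PiE_iff extensional_def)

text \<open>Serves to show that additive maps preserve zero, since the image of zero is its own
  double.\<close>

lemma (in abelian_group) double_eq_self_imp_zero:
  assumes "x \<in> carrier G" "x \<oplus> x = x"
  shows "x = \<zero>"
  using assms by (metis add.r_cancel_one')

lemma rmod_hom_zero:
  assumes "f \<in> rmod_hom R M N" "abelian_group M" "abelian_group N"
  shows "f \<zero>\<^bsub>M\<^esub> = \<zero>\<^bsub>N\<^esub>"
proof -
  interpret M: abelian_group M by fact
  interpret N: abelian_group N by fact
  have "f \<zero>\<^bsub>M\<^esub> \<oplus>\<^bsub>N\<^esub> f \<zero>\<^bsub>M\<^esub> = f \<zero>\<^bsub>M\<^esub>"
    using rmod_hom_add[OF assms(1), of "\<zero>\<^bsub>M\<^esub>" "\<zero>\<^bsub>M\<^esub>"] by simp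
  then show ?thesis
    using rmod_hom_closed[OF assms(1)] by (intro N.double_eq_self_imp_zero) auto
qed

lemma rmod_hom_compose:
  assumes "right_module R L" "f \<in> rmod_hom R L M" "g \<in> rmod_hom R M N"
  shows "compose (carrier L) g f \<in> rmod_hom R L N"
proof -
  interpret L: right_module R L by fact
  note f = assms(2) and g = assms(3)
  show ?thesis
    by (rule rmod_homI)
      (auto simp: compose_def rmod_hom_closed[OF f] rmod_hom_closed[OF g] rmod_hom_add[OF f]
        rmod_hom_add[OF g] rmod_hom_ract[OF f] rmod_hom_ract[OF g] L.ract_closed)
qed

lemma rmod_hom_id: "(\<lambda>x\<in>carrier M. x) \<in> rmod_hom R M M" if "right_module R M"
proof -
  interpret M: right_module R M by (rule that)
  show ?thesis by (rule rmod_homI) (auto simp: M.ract_closed)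
qed

lemma (in right_module) ract_zero_left [simp]:
  assumes "r \<in> carrier R" shows "\<zero>\<^bsub>M\<^esub> \<star>\<^bsub>M\<^esub> r = \<zero>\<^bsub>M\<^esub>"
  using ract_add_left[of "\<zero>\<^bsub>M\<^esub>" "\<zero>\<^bsub>M\<^esub>" r] assms
  by (intro M.double_eq_self_imp_zero) (auto intro: ract_closed)

lemma (in right_module) ract_zero_right [simp]:
  assumes "x \<in> carrier M" shows "x \<star>\<^bsub>M\<^esub> \<zero>\<^bsub>R\<^esub> = \<zero>\<^bsub>M\<^esub>"
  using ract_add_right[of x "\<zero>\<^bsub>R\<^esub>" "\<zero>\<^bsub>R\<^esub>"] assms
  by (intro M.double_eq_self_imp_zero) (auto intro: ract_closed)

lemma (in right_module) ract_minus:
  assumes "x \<in> carrier M" "r \<in> carrier R"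
  shows "(\<ominus>\<^bsub>M\<^esub> x) \<star>\<^bsub>M\<^esub> r = \<ominus>\<^bsub>M\<^esub> (x \<star>\<^bsub>M\<^esub> r)"
  using assms ract_add_left[of "\<ominus>\<^bsub>M\<^esub> x" x r]
  by (intro M.minus_equality[symmetric]) (auto simp: ract_closed M.l_neg)

lemma rmod_hom_neg:
  assumes "right_module R M" "right_module R N" "f \<in> rmod_hom R M N"
  shows "(\<lambda>x\<in>carrier M. \<ominus>\<^bsub>N\<^esub> f x) \<in> rmod_hom R M N"
proof -
  interpret M: right_module R M by fact
  interpret N: right_module R N by fact
  note cl = rmod_hom_closed[OF assms(3)]
  show ?thesis
    by (rule rmod_homI)
      (auto simp: cl M.ract_closed rmod_hom_add[OF assms(3)] rmod_hom_ract[OF assms(3)]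
        N.M.minus_add N.M.a_comm N.ract_minus)
qed

lemma rmod_hom_minus:
  assumes "f \<in> rmod_hom R M N" "abelian_group M" "abelian_group N" "x \<in> carrier M"
  shows "f (\<ominus>\<^bsub>M\<^esub> x) = \<ominus>\<^bsub>N\<^esub> f x"
proof -
  interpret M: abelian_group M by fact
  interpret N: abelian_group N by fact
  have "f (\<ominus>\<^bsub>M\<^esub> x) \<oplus>\<^bsub>N\<^esub> f x = \<zero>\<^bsub>N\<^esub>"
    using assms by (simp add: rmod_hom_add[OF assms(1), symmetric] M.l_neg rmod_hom_zero)
  then show ?thesis
    using assms rmod_hom_closed[OF assms(1)] by (intro N.minus_equality[symmetric]) auto
qed

section \<open>The category of right modules and its isomorphisms\<close>

lemma category_Mod: "category (Mod \<kappa> R)"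
proof (unfold_locales, goal_cases)
  case (3 w x y z f g h)
  then show ?case
    by (auto simp: Mod_def intro!: compose_assoc rmod_hom_funcset)
qed (auto simp: Mod_def intro: rmod_hom_id rmod_hom_compose
    intro!: compose_Id Id_compose rmod_hom_funcset rmod_hom_extensional)

text \<open>The set-theoretic inverse of a bijective linear map is linear, as one sees by writing
  its arguments as images under \<open>f\<close>. It is restricted to the carrier of
  \<open>N\<close> because arrows are extensional.\<close>

lemma iso_in_Mod:
  assumes M: "right_module R M" and f: "f \<in> rmod_hom R M N"
    and bij: "bij_betw f (carrier M) (carrier N)"
  shows "iso_in (Mod \<kappa> R) M N f"
proof -
  interpret M: right_module R M by (rule M)
  let ?g = "\<lambda>y\<in>carrier N. inv_into (carrier M) f y"
  have g: "y \<in> carrier N \<Longrightarrow> inv_into (carrier M) f y \<in> carrier M \<and> f (inv_into (carrier M) f y) = y" for y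
    using bij by (metis bij_betw_def f_inv_into_f inv_into_into)
  have gI: "inv_into (carrier M) f y = x" if "x \<in> carrier M" "f x = y" for x y
    using bij that by (metis bij_betw_inv_into_left)
  have "?g \<in> rmod_hom R N M"
  proof (rule rmod_homI)
    fix y z assume yz: "y \<in> carrier N" "z \<in> carrier N"
    then obtain u v where uv: "u \<in> carrier M" "v \<in> carrier M" "y = f u" "z = f v"
      using g by metis
    then have "y \<oplus>\<^bsub>N\<^esub> z = f (u \<oplus>\<^bsub>M\<^esub> v)" by (simp add: rmod_hom_add[OF f])
    with uv show "?g (y \<oplus>\<^bsub>N\<^esub> z) = ?g y \<oplus>\<^bsub>M\<^esub> ?g z"
      by (simp add: gI[OF _ refl] rmod_hom_closed[OF f])
  next
    fix y r assume yr: "y \<in> carrier N" "r \<in> carrier R"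
    then obtain u where u: "u \<in> carrier M" "y = f u" using g by metis
    then have "y \<star>\<^bsub>N\<^esub> r = f (u \<star>\<^bsub>M\<^esub> r)" using yr by (simp add: rmod_hom_ract[OF f])
    with u yr show "?g (y \<star>\<^bsub>N\<^esub> r) = ?g y \<star>\<^bsub>M\<^esub> r"
      by (simp add: gI[OF _ refl] rmod_hom_closed[OF f] M.ract_closed)
  qed (use g in auto)
  then show ?thesis
    using f bij
    by (intro iso_inI[where g = ?g])
      (auto simp: Mod_def compose_inv_into_id compose_id_inv_into bij_betw_imp_surj_on)
qed

text \<open>
  The elements of a module over \<open>End(U)\<close> and those of the persistence modules have different types;
  smallness provides an injection between them, along which modules are transported.
\<close>

definition rmodule_image :: "('m \<Rightarrow> 'n) \<Rightarrow> ('r, 'm) rmodule \<Rightarrow> ('r, 'n) rmodule" where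
  "rmodule_image j M = \<lparr>carrier = j ` carrier M, mult = undefined, one = undefined,
     zero = j \<zero>\<^bsub>M\<^esub>,
     add = (\<lambda>x y. j (inv_into (carrier M) j x \<oplus>\<^bsub>M\<^esub> inv_into (carrier M) j y)),
     ract = (\<lambda>x r. j (inv_into (carrier M) j x \<star>\<^bsub>M\<^esub> r))\<rparr>"

lemma rmodule_image_simps [simp]:
  "carrier (rmodule_image j M) = j ` carrier M"
  "\<zero>\<^bsub>rmodule_image j M\<^esub> = j \<zero>\<^bsub>M\<^esub>"
  "\<lbrakk>inj_on j (carrier M); x \<in> carrier M; y \<in> carrier M\<rbrakk>
    \<Longrightarrow> j x \<oplus>\<^bsub>rmodule_image j M\<^esub> j y = j (x \<oplus>\<^bsub>M\<^esub> y)"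
  "\<lbrakk>inj_on j (carrier M); x \<in> carrier M\<rbrakk> \<Longrightarrow> j x \<star>\<^bsub>rmodule_image j M\<^esub> r = j (x \<star>\<^bsub>M\<^esub> r)"
  by (simp_all add: rmodule_image_def)

lemma right_module_image:
  assumes "right_module R M" "inj_on j (carrier M)"
  shows "right_module R (rmodule_image j M)"
proof -
  interpret M: right_module R M by fact
  have "abelian_group (rmodule_image j M)"
    by (rule abelian_groupI) (auto simp: assms M.M.a_ac intro!: bexI[where x = "\<ominus>\<^bsub>M\<^esub> _"] arg_cong[where f = j] M.M.r_neg)
  then show ?thesis
    by (intro right_module.intro right_module_axioms.intro M.R.ring_axioms)
      (auto simp: assms M.ract_closed M.ract_add_left M.ract_add_right M.ract_mult M.ract_one)
qed

section \<open>Cardinalities of finite products of small sets\<close>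

lemma finite_card_of_ordLess:
  assumes "finite A" "Card_order \<kappa>" "infinite (Field \<kappa>)"
  shows "|A| <o \<kappa>"
  using assms finite_ordLess_infinite[of "|A|" \<kappa>]
  by (simp add: card_of_well_order_on card_order_on_def Field_card_of)

text \<open>An infinite product of two sets has the cardinality of the larger factor, and a finite
  one lies below the infinite cardinal \<open>\<kappa>\<close>.\<close>

lemma card_of_Times_ordLess:
  assumes \<kappa>: "Card_order \<kappa>" "infinite (Field \<kappa>)" and A: "|A| <o \<kappa>" and B: "|B| <o \<kappa>"
  shows "|A \<times> B| <o \<kappa>"
proof (cases "finite (A \<times> B)")
  case True
  then show ?thesis using \<kappa> by (rule finite_card_of_ordLess)
next
  case False
  then have ne: "A \<noteq> {}" "B \<noteq> {}" by auto
  consider "|A| \<le>o |B|" | "|B| \<le>o |A|"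
    using ordLeq_total[OF card_of_Well_order card_of_Well_order] by blast
  then show ?thesis
  proof cases
    case 1
    then have "infinite B" using False card_of_ordLeq_finite[of A B] by auto
    then show ?thesis using card_of_Times_infinite[OF _ ne(1) 1] B ordIso_ordLess_trans by blast
  next
    case 2
    then have "infinite A" using False card_of_ordLeq_finite[of B A] by auto
    then show ?thesis using card_of_Times_infinite[OF _ ne(2) 2] A ordIso_ordLess_trans by blast
  qed
qed

text \<open>Induction on the index set: a family over \<open>insert i S\<close> is determined by its
  value at \<open>i\<close> and its restriction to \<open>S\<close>, which embeds the product into a
  product of two small sets.\<close>

lemma card_of_PiE_ordLess:
  assumes "finite S" "Card_order \<kappa>" "infinite (Field \<kappa>)" "\<And>i. i \<in> S \<Longrightarrow> |A i| <o \<kappa>"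
  shows "|PiE S A| <o \<kappa>"
  using assms(1,4)
proof (induction S)
  case empty
  then show ?case
    using assms(2,3) by (simp add: finite_card_of_ordLess)
next
  case (insert i S)
  have "inj_on (\<lambda>f. (f i, restrict f S)) (PiE (insert i S) A)"
    by (rule inj_onI, rule PiE_ext, assumption, assumption) (auto, metis restrict_apply')
  then have "|PiE (insert i S) A| \<le>o |A i \<times> PiE S A|"
    by (rule card_of_ordLeqI) auto
  moreover have "|A i \<times> PiE S A| <o \<kappa>"
    using insert assms by (intro card_of_Times_ordLess) auto
  ultimately show ?case by (rule ordLeq_ordLess_trans)
qed

section \<open>Persistence modules in terms of elements\<close>

text \<open>The bound by \<open>\<kappa>\<close> is kept apart from the functor laws because
  \<open>U\<close> has to be covered as well, and its values may be as large as
  \<open>R\<close>.\<close>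

locale pers_module =
  fixes P :: "'p set" and leq :: "'p rel" and R :: "('r, 'x) ring_scheme"
    and M :: "('p, 'r, 'm) pmodule"
  assumes FObj_module: "b \<in> P \<Longrightarrow> right_module R (FObj M b)"
    and FArr_hom: "\<lbrakk>b \<in> P; c \<in> P; (b, c) \<in> leq\<rbrakk> \<Longrightarrow> FArr M b c () \<in> rmod_hom R (FObj M b) (FObj M c)"
    and FArr_id: "\<lbrakk>b \<in> P; x \<in> carrier (FObj M b)\<rbrakk> \<Longrightarrow> FArr M b b () x = x"
    and FArr_comp: "\<lbrakk>a \<in> P; b \<in> P; c \<in> P; (a, b) \<in> leq; (b, c) \<in> leq; x \<in> carrier (FObj M a)\<rbrakk>
      \<Longrightarrow> FArr M b c () (FArr M a b () x) = FArr M a c () x"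

lemma category_preorder_cat:
  assumes "preorder_on P leq"
  shows "category (preorder_cat P leq)"
  using assms
  by unfold_locales
    (auto simp: preorder_cat_def preorder_on_def refl_on_def dest: transD split: if_splits)

text \<open>The functor laws are equations between restricted functions, those of
  \<open>pers_module\<close> are equations between elements; extensionality of linear maps leads
  from the second to the first.\<close>

lemma PMod_Obj_iff:
  assumes "preorder_on P leq"
  shows "M \<in> Obj (PMod \<kappa> P leq R) \<longleftrightarrow>
    pers_module P leq R M \<and> (\<forall>b\<in>P. |carrier (FObj M b)| <o \<kappa>)" (is "?L \<longleftrightarrow> ?Q")
proof
  assume ?L
  then interpret F: cat_functor "preorder_cat P leq" "Mod \<kappa> R" M by (simp add: functor_cat_def)
  have refl: "b \<in> P \<Longrightarrow> (b, b) \<in> leq" for b using assms by (auto simp: preorder_on_def refl_on_def)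
  have "pers_module P leq R M"
  proof (rule pers_module.intro, goal_cases)
    case (1 b)
    then show ?case using F.FObj_Obj[of b] by (auto simp: preorder_cat_def Mod_def)
  next
    case (2 b c)
    then show ?case using F.FArr_Hom[of b c "()"] by (auto simp: preorder_cat_def Mod_def)
  next
    case (3 b x)
    then show ?case using F.FArr_Ide[of b] by (auto simp: preorder_cat_def Mod_def)
  next
    case (4 a b c x)
    then show ?case using F.FArr_Comp[of a b c "()" "()"]
      by (auto simp: preorder_cat_def Mod_def compose_eq)
  qed
  moreover have "\<forall>b\<in>P. |carrier (FObj M b)| <o \<kappa>"
    using F.FObj_Obj by (auto simp: preorder_cat_def Mod_def)
  ultimately show ?Q by simp
next
  assume Q: ?Q
  then interpret M: pers_module P leq R M by simp
  have "cat_functor (preorder_cat P leq) (Mod \<kappa> R) M"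
  proof (intro cat_functor.intro category_preorder_cat assms category_Mod cat_functor_axioms.intro,
      goal_cases)
    case (1 b)
    then show ?case using Q M.FObj_module by (auto simp: preorder_cat_def Mod_def)
  next
    case (2 b c f)
    then show ?case using M.FArr_hom by (auto simp: preorder_cat_def Mod_def split: if_splits)
  next
    case (3 b)
    moreover have "(b, b) \<in> leq" if "b \<in> P"
      using assms that by (auto simp: preorder_on_def refl_on_def)
    ultimately show ?case
      using M.FArr_hom[of b b]
      by (intro extensionalityI[where A = "carrier (FObj M b)"])
        (auto simp: preorder_cat_def Mod_def M.FArr_id rmod_hom_extensional)
  next
    case (4 a b c f g)
    then have *: "a \<in> P" "b \<in> P" "c \<in> P" "(a, b) \<in> leq" "(b, c) \<in> leq"
      by (auto simp: preorder_cat_def split: if_splits)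
    then have "(a, c) \<in> leq" using assms by (auto simp: preorder_on_def dest: transD)
    with * show ?case
      using M.FArr_hom[of a c]
      by (intro extensionalityI[where A = "carrier (FObj M a)"])
        (auto simp: preorder_cat_def Mod_def M.FArr_comp rmod_hom_extensional compose_eq)
  qed
  then show ?L by (simp add: functor_cat_def)
qed

text \<open>One map \<open>j\<close> serves all points \<open>b\<close>, since the modules to be
  transported, those of \<open>corner N\<close> below, all lie inside the carrier of
  \<open>N\<close>.\<close>

definition pmod_image :: "('m \<Rightarrow> 'n) \<Rightarrow> ('p, 'r, 'm) pmodule \<Rightarrow> ('p, 'r, 'n) pmodule" where
  "pmod_image j M = \<lparr>
     FObj = (\<lambda>b. rmodule_image j (FObj M b)),
     FArr = (\<lambda>b c u. \<lambda>x\<in>j ` carrier (FObj M b). j (FArr M b c u (inv_into (carrier (FObj M b)) j x)))\<rparr>"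

lemma FObj_pmod_image [simp]: "FObj (pmod_image j M) b = rmodule_image j (FObj M b)"
  by (simp add: pmod_image_def)

lemma FArr_pmod_image [simp]:
  "\<lbrakk>inj_on j (carrier (FObj M b)); x \<in> carrier (FObj M b)\<rbrakk>
    \<Longrightarrow> FArr (pmod_image j M) b c u (j x) = j (FArr M b c u x)"
  by (simp add: pmod_image_def)

lemma pers_module_image:
  assumes "pers_module P leq R M" "\<And>b. b \<in> P \<Longrightarrow> inj_on j (carrier (FObj M b))"
  shows "pers_module P leq R (pmod_image j M)"
proof -
  interpret M: pers_module P leq R M by fact
  show ?thesis
  proof (rule pers_module.intro, goal_cases)
    case (1 b)
    then show ?case using M.FObj_module assms by (auto intro: right_module_image)
  next
    case (2 b c)
    interpret Mb: right_module R "FObj M b" using 2 M.FObj_module by simp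
    note h = M.FArr_hom[OF 2]
    show ?case
      by (rule rmod_homI)
        (use 2 in \<open>auto simp: assms(2) rmod_hom_closed[OF h] rmod_hom_add[OF h] rmod_hom_ract[OF h]
          Mb.ract_closed, auto simp: pmod_image_def\<close>)
  next
    case (3 b x)
    then show ?case by (auto simp: assms M.FArr_id)
  next
    case (4 a b c x)
    then show ?case
      using rmod_hom_closed[OF M.FArr_hom] by (auto simp: assms M.FArr_comp)
  qed
qed

section \<open>The generator and its endomorphism ring\<close>

lemma compose_eq_iff: "compose A g f = compose A g' f' \<longleftrightarrow> (\<forall>x\<in>A. g (f x) = g' (f' x))"
  by (auto simp: compose_def fun_eq_iff restrict_def)

locale finite_preorder_ring = R: ring R
  for P :: "'p set" and leq :: "'p rel" and R :: "('r, 'x) ring_scheme" (structure) +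
  assumes finite_P: "finite P" and preorder: "preorder_on P leq"
begin

definition U :: "('p, 'r, 'p \<Rightarrow> 'r) pmodule" where
  "U = pmod_dsum P (\<lambda>a. indicator_pmod R (up_set P leq a))"

abbreviation hom_U :: "('p, 'r, 'm) pmodule \<Rightarrow> ('p \<Rightarrow> ('p \<Rightarrow> 'r) \<Rightarrow> 'm) set" where
  "hom_U M \<equiv> pmod_hom P leq R U M"

abbreviation HomU ::
  "('p, 'r, 'm) pmodule \<Rightarrow> ('p \<Rightarrow> ('p \<Rightarrow> 'r) \<Rightarrow> 'p \<Rightarrow> 'r, 'p \<Rightarrow> ('p \<Rightarrow> 'r) \<Rightarrow> 'm) rmodule" where
  "HomU M \<equiv> Hom_rmodule P leq R U M"

abbreviation EndU :: "('p \<Rightarrow> ('p \<Rightarrow> 'r) \<Rightarrow> 'p \<Rightarrow> 'r) ring" where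
  "EndU \<equiv> End_ring P leq R U"

abbreviation pers :: "('p, 'r, 'm) pmodule \<Rightarrow> bool" where
  "pers M \<equiv> pers_module P leq R M"

lemma leq_refl: "a \<in> P \<Longrightarrow> (a, a) \<in> leq"
  using preorder by (auto simp: preorder_on_def refl_on_def)

lemma leq_trans: "\<lbrakk>(a, b) \<in> leq; (b, c) \<in> leq\<rbrakk> \<Longrightarrow> (a, c) \<in> leq"
  using preorder by (auto simp: preorder_on_def dest: transD)

text \<open>Coordinate \<open>a\<close> of a vector at \<open>b\<close> lies in
  \<open>R[U\<^sub>a] b\<close>, which is \<open>R\<close> if \<open>a \<le> b\<close> and zero
  otherwise. Finiteness of the support is automatic, as \<open>P\<close> is finite.\<close>

lemma carrier_U:
  assumes "b \<in> P"
  shows "x \<in> carrier (FObj U b) \<longleftrightarrow>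
    x \<in> P \<rightarrow>\<^sub>E carrier R \<and> (\<forall>a\<in>P. (a, b) \<notin> leq \<longrightarrow> x a = \<zero>)"
  using assms finite_P
  by (auto simp: U_def pmod_dsum_def rmod_dsum_def indicator_pmod_def up_set_def PiE_iff
      regular_rmodule_def zero_rmodule_def split: if_splits)

lemma U_simps:
  "\<zero>\<^bsub>FObj U b\<^esub> = (\<lambda>i\<in>P. \<zero>)"
  "x \<oplus>\<^bsub>FObj U b\<^esub> y = (\<lambda>i\<in>P. x i \<oplus> y i)"
  "x \<star>\<^bsub>FObj U b\<^esub> r = (\<lambda>i\<in>P. x i \<otimes> r)"
  by (auto simp: U_def pmod_dsum_def rmod_dsum_def indicator_pmod_def
      regular_rmodule_def zero_rmodule_def)

lemma carrier_U_apply: "\<lbrakk>b \<in> P; x \<in> carrier (FObj U b); a \<in> P\<rbrakk> \<Longrightarrow> x a \<in> carrier R"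
  by (auto simp: carrier_U)

lemma carrier_U_extensional: "\<lbrakk>b \<in> P; x \<in> carrier (FObj U b)\<rbrakk> \<Longrightarrow> x \<in> extensional P"
  by (auto simp: carrier_U PiE_iff)

lemma carrier_U_zero: "\<lbrakk>b \<in> P; x \<in> carrier (FObj U b); a \<in> P; (a, b) \<notin> leq\<rbrakk> \<Longrightarrow> x a = \<zero>"
  by (auto simp: carrier_U)

lemma carrier_U_mono:
  "\<lbrakk>b \<in> P; c \<in> P; (b, c) \<in> leq; x \<in> carrier (FObj U b)\<rbrakk> \<Longrightarrow> x \<in> carrier (FObj U c)"
  by (auto simp: carrier_U dest: leq_trans)

lemma carrier_U_ext:
  assumes "b \<in> P" "x \<in> carrier (FObj U b)" "y \<in> extensional P" "\<And>i. i \<in> P \<Longrightarrow> x i = y i"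
  shows "x = y"
  using assms carrier_U_extensional by (metis extensionalityI)

text \<open>The structure maps of \<open>U\<close> are inclusions. A coordinate
  \<open>i \<le> b\<close> also satisfies \<open>i \<le> c\<close>, and the map on it is the
  identity; every other coordinate of \<open>x\<close> is zero and is sent to zero.\<close>

lemma FArr_U:
  assumes "b \<in> P" "c \<in> P" "(b, c) \<in> leq" "x \<in> carrier (FObj U b)"
  shows "FArr U b c u x = x"
proof -
  have "FArr U b c u x = (\<lambda>i\<in>P. FArr (indicator_pmod R (up_set P leq i)) b c u (x i))"
    using assms(4) by (simp add: U_def pmod_dsum_def)
  also have "\<dots> = x"
    using assms carrier_U_apply[OF assms(1,4)] carrier_U_zero[OF assms(1,4)]
    by (intro carrier_U_ext[symmetric, OF assms(1,4)])
      (auto simp: indicator_pmod_def up_set_def zero_rmodule_def dest: leq_trans)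
  finally show ?thesis .
qed

lemma right_module_U:
  assumes b: "b \<in> P"
  shows "right_module R (FObj U b)"
proof -
  have "abelian_group (FObj U b)"
  proof (rule abelian_groupI, goal_cases)
    case (5 x)
    then show ?case
      using carrier_U_apply[OF b] carrier_U_extensional[OF b]
      by (intro carrier_U_ext[symmetric, OF b]) (auto simp: U_simps)
  next
    case (6 x)
    then show ?case
      using b by (intro bexI[where x = "\<lambda>i\<in>P. \<ominus> x i"]) (auto simp: carrier_U U_simps R.l_neg PiE_iff intro!: restrict_ext)
  qed (use b in \<open>auto simp: carrier_U U_simps R.a_ac PiE_iff intro!: restrict_ext\<close>)
  then show ?thesis
  proof (intro right_module.intro right_module_axioms.intro R.ring_axioms, goal_cases)
    case (6 x)
    then show ?case
      using carrier_U_apply[OF b] carrier_U_extensional[OF b]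
      by (intro carrier_U_ext[symmetric, OF b]) (auto simp: U_simps)
  qed (use b in \<open>auto simp: carrier_U U_simps R.l_distr R.r_distr R.m_assoc PiE_iff intro!: restrict_ext\<close>)
qed

lemma pers_U: "pers U"
proof (rule pers_module.intro)
  fix b c assume bc: "b \<in> P" "c \<in> P" "(b, c) \<in> leq"
  interpret Ub: right_module R "FObj U b" using bc by (intro right_module_U)
  show "FArr U b c () \<in> rmod_hom R (FObj U b) (FObj U c)"
  proof (rule rmod_homI)
    fix x assume "x \<notin> carrier (FObj U b)"
    then show "FArr U b c () x = undefined" by (simp add: U_def pmod_dsum_def)
  next
    fix x y assume "x \<in> carrier (FObj U b)" "y \<in> carrier (FObj U b)"
    then show "FArr U b c () (x \<oplus>\<^bsub>FObj U b\<^esub> y) = FArr U b c () x \<oplus>\<^bsub>FObj U c\<^esub> FArr U b c () y"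
      using bc Ub.M.a_closed by (simp add: FArr_U) (simp add: U_simps)
  next
    fix x r assume "x \<in> carrier (FObj U b)" "r \<in> carrier R"
    then show "FArr U b c () (x \<star>\<^bsub>FObj U b\<^esub> r) = FArr U b c () x \<star>\<^bsub>FObj U c\<^esub> r"
      using bc Ub.ract_closed by (simp add: FArr_U) (simp add: U_simps)
  qed (use bc in \<open>auto simp: FArr_U carrier_U_mono\<close>)
qed (auto simp: right_module_U FArr_U leq_refl carrier_U_mono dest: leq_trans)

section \<open>Homomorphisms out of the generator\<close>

text \<open>Structure maps of \<open>U\<close>, being inclusions, drop out of the naturality
  square.\<close>

lemma hom_U_iff:
  assumes "pers M"
  shows "\<eta> \<in> hom_U M \<longleftrightarrow> \<eta> \<in> extensional P \<and>
    (\<forall>b\<in>P. \<eta> b \<in> rmod_hom R (FObj U b) (FObj M b)) \<and>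
    (\<forall>b\<in>P. \<forall>c\<in>P. \<forall>x\<in>carrier (FObj U b). (b, c) \<in> leq \<longrightarrow> \<eta> c x = FArr M b c () (\<eta> b x))"
proof -
  have "compose (carrier (FObj U b)) (\<eta> c) (FArr U b c ()) =
        compose (carrier (FObj U b)) (FArr M b c ()) (\<eta> b) \<longleftrightarrow>
      (\<forall>x\<in>carrier (FObj U b). \<eta> c x = FArr M b c () (\<eta> b x))"
    if "b \<in> P" "c \<in> P" "(b, c) \<in> leq" for b c
    using FArr_U[OF that] by (simp add: compose_eq_iff)
  then show ?thesis
    by (auto simp: pmod_hom_def PiE_iff)
qed

lemma hom_UI:
  assumes "pers M" "\<eta> \<in> extensional P"
    and "\<And>b. b \<in> P \<Longrightarrow> \<eta> b \<in> rmod_hom R (FObj U b) (FObj M b)"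
    and "\<And>b c x. \<lbrakk>b \<in> P; c \<in> P; x \<in> carrier (FObj U b); (b, c) \<in> leq\<rbrakk>
      \<Longrightarrow> \<eta> c x = FArr M b c () (\<eta> b x)"
  shows "\<eta> \<in> hom_U M"
  using assms by (simp add: hom_U_iff)

lemma hom_U_hom: "\<lbrakk>\<eta> \<in> hom_U M; b \<in> P\<rbrakk> \<Longrightarrow> \<eta> b \<in> rmod_hom R (FObj U b) (FObj M b)"
  by (auto simp: pmod_hom_def)

lemma hom_U_closed: "\<lbrakk>\<eta> \<in> hom_U M; b \<in> P; x \<in> carrier (FObj U b)\<rbrakk> \<Longrightarrow> \<eta> b x \<in> carrier (FObj M b)"
  using hom_U_hom rmod_hom_closed by metis

lemma hom_U_natural:
  "\<lbrakk>pers M; \<eta> \<in> hom_U M; b \<in> P; c \<in> P; x \<in> carrier (FObj U b); (b, c) \<in> leq\<rbrakk>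
    \<Longrightarrow> \<eta> c x = FArr M b c () (\<eta> b x)"
  by (simp add: hom_U_iff)

lemma hom_U_ext:
  assumes "\<eta> \<in> hom_U M" "\<theta> \<in> hom_U N"
    and "\<And>b x. \<lbrakk>b \<in> P; x \<in> carrier (FObj U b)\<rbrakk> \<Longrightarrow> \<eta> b x = \<theta> b x"
  shows "\<eta> = \<theta>"
proof (rule extensionalityI[where A = P])
  fix b assume "b \<in> P"
  then show "\<eta> b = \<theta> b"
    using assms by (intro extensionalityI[where A = "carrier (FObj U b)"])
      (auto intro: rmod_hom_extensional hom_U_hom)
qed (use assms in \<open>auto simp: pmod_hom_def PiE_iff\<close>)

lemma pmod_comp_apply [simp]:
  "\<lbrakk>b \<in> P; x \<in> carrier (FObj U b)\<rbrakk> \<Longrightarrow> pmod_comp P U \<beta> \<alpha> b x = \<beta> b (\<alpha> b x)"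
  by (simp add: pmod_comp_def compose_eq)

text \<open>Used in two roles: with \<open>M = U\<close> it makes \<open>EndU\<close> act on
  \<open>HomU N\<close> from the right, and for general \<open>M\<close> it gives the values of the
  functor on arrows.\<close>

lemma pmod_comp_hom_U:
  assumes M: "pers M" and N: "pers N" and \<eta>: "\<eta> \<in> hom_U M" and \<phi>: "\<phi> \<in> pmod_hom P leq R M N"
  shows "pmod_comp P U \<phi> \<eta> \<in> hom_U N"
proof (rule hom_UI[OF N])
  fix b assume "b \<in> P"
  then show "pmod_comp P U \<phi> \<eta> b \<in> rmod_hom R (FObj U b) (FObj N b)"
    using \<eta> \<phi> by (auto simp: pmod_comp_def pmod_hom_def intro!: rmod_hom_compose right_module_U)
next
  fix b c x assume h: "b \<in> P" "c \<in> P" "x \<in> carrier (FObj U b)" "(b, c) \<in> leq"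
  then have "compose (carrier (FObj M b)) (\<phi> c) (FArr M b c ()) (\<eta> b x) =
      compose (carrier (FObj M b)) (FArr N b c ()) (\<phi> b) (\<eta> b x)"
    using \<phi> by (auto simp: pmod_hom_def)
  then show "pmod_comp P U \<phi> \<eta> c x = FArr N b c () (pmod_comp P U \<phi> \<eta> b x)"
    using h by (simp add: carrier_U_mono compose_eq hom_U_closed[OF \<eta>] hom_U_natural[OF M \<eta>])
qed (simp add: pmod_comp_def)

section \<open>The ring \<open>End(U)\<close> and the right modules \<open>Hom(U, M)\<close>\<close>

lemma HomU_carrier [simp]: "carrier (HomU M) = hom_U M" "carrier EndU = hom_U U"
  by (simp_all add: Hom_rmodule_def End_ring_def)

lemma HomU_ract [simp]: "\<eta> \<star>\<^bsub>HomU M\<^esub> \<alpha> = pmod_comp P U \<eta> \<alpha>"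
  by (simp add: Hom_rmodule_def)

lemma EndU_mult [simp]: "\<alpha> \<otimes>\<^bsub>EndU\<^esub> \<beta> = pmod_comp P U \<alpha> \<beta>"
  by (simp add: End_ring_def)

text \<open>Lets the group laws proved for all \<open>HomU M\<close> serve for the ring too.\<close>

lemma EndU_eq_HomU: "\<zero>\<^bsub>EndU\<^esub> = \<zero>\<^bsub>HomU U\<^esub>" "(\<oplus>\<^bsub>EndU\<^esub>) = (\<oplus>\<^bsub>HomU U\<^esub>)"
  by (simp_all add: Hom_rmodule_def End_ring_def)

lemma HomU_apply [simp]:
  assumes "b \<in> P" "x \<in> carrier (FObj U b)"
  shows "\<zero>\<^bsub>HomU M\<^esub> b x = \<zero>\<^bsub>FObj M b\<^esub>"
    and "(\<eta> \<oplus>\<^bsub>HomU M\<^esub> \<theta>) b x = \<eta> b x \<oplus>\<^bsub>FObj M b\<^esub> \<theta> b x"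
    and "\<one>\<^bsub>EndU\<^esub> b x = x"
  using assms by (simp_all add: Hom_rmodule_def End_ring_def)

lemma HomU_zero_closed:
  assumes M: "pers M" shows "\<zero>\<^bsub>HomU M\<^esub> \<in> hom_U M"
proof (rule hom_UI[OF M])
  interpret M: pers_module P leq R M by (rule M)
  fix b assume b: "b \<in> P"
  interpret Mb: right_module R "FObj M b" using b by (rule M.FObj_module)
  interpret Ub: right_module R "FObj U b" using b by (rule right_module_U)
  show "\<zero>\<^bsub>HomU M\<^esub> b \<in> rmod_hom R (FObj U b) (FObj M b)"
    using b by (intro rmod_homI) (auto simp: Ub.ract_closed, auto simp: Hom_rmodule_def)
next
  interpret M: pers_module P leq R M by (rule M)
  fix b c x assume "b \<in> P" "c \<in> P" "x \<in> carrier (FObj U b)" "(b, c) \<in> leq"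
  then show "\<zero>\<^bsub>HomU M\<^esub> c x = FArr M b c () (\<zero>\<^bsub>HomU M\<^esub> b x)"
    using M.FObj_module
    by (simp add: carrier_U_mono rmod_hom_zero[OF M.FArr_hom] right_module_def)
qed (simp add: Hom_rmodule_def)

lemma HomU_add_closed:
  assumes M: "pers M" and \<eta>: "\<eta> \<in> hom_U M" and \<theta>: "\<theta> \<in> hom_U M"
  shows "\<eta> \<oplus>\<^bsub>HomU M\<^esub> \<theta> \<in> hom_U M"
proof (rule hom_UI[OF M])
  interpret M: pers_module P leq R M by (rule M)
  fix b assume b: "b \<in> P"
  interpret Mb: right_module R "FObj M b" using b by (rule M.FObj_module)
  interpret Ub: right_module R "FObj U b" using b by (rule right_module_U)
  note cl = hom_U_closed[OF \<eta> b] hom_U_closed[OF \<theta> b]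
  show "(\<eta> \<oplus>\<^bsub>HomU M\<^esub> \<theta>) b \<in> rmod_hom R (FObj U b) (FObj M b)"
  proof (rule rmod_homI)
    fix x y assume "x \<in> carrier (FObj U b)" "y \<in> carrier (FObj U b)"
    then show "(\<eta> \<oplus>\<^bsub>HomU M\<^esub> \<theta>) b (x \<oplus>\<^bsub>FObj U b\<^esub> y) =
        (\<eta> \<oplus>\<^bsub>HomU M\<^esub> \<theta>) b x \<oplus>\<^bsub>FObj M b\<^esub> (\<eta> \<oplus>\<^bsub>HomU M\<^esub> \<theta>) b y"
      using b by (simp add: cl Mb.M.a_ac rmod_hom_add[OF hom_U_hom[OF \<eta> b]]
          rmod_hom_add[OF hom_U_hom[OF \<theta> b]])
  next
    fix x r assume "x \<in> carrier (FObj U b)" "r \<in> carrier R"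
    then show "(\<eta> \<oplus>\<^bsub>HomU M\<^esub> \<theta>) b (x \<star>\<^bsub>FObj U b\<^esub> r) = (\<eta> \<oplus>\<^bsub>HomU M\<^esub> \<theta>) b x \<star>\<^bsub>FObj M b\<^esub> r"
      using b by (simp add: cl Mb.ract_add_left Ub.ract_closed rmod_hom_ract[OF hom_U_hom[OF \<eta> b]]
          rmod_hom_ract[OF hom_U_hom[OF \<theta> b]])
  qed (use b cl in \<open>auto, auto simp: Hom_rmodule_def\<close>)
next
  interpret M: pers_module P leq R M by (rule M)
  fix b c x assume "b \<in> P" "c \<in> P" "x \<in> carrier (FObj U b)" "(b, c) \<in> leq"
  then show "(\<eta> \<oplus>\<^bsub>HomU M\<^esub> \<theta>) c x = FArr M b c () ((\<eta> \<oplus>\<^bsub>HomU M\<^esub> \<theta>) b x)"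
    by (simp add: carrier_U_mono hom_U_natural[OF M \<eta>] hom_U_natural[OF M \<theta>] hom_U_closed[OF \<eta>]
        hom_U_closed[OF \<theta>] rmod_hom_add[OF M.FArr_hom])
qed (simp add: Hom_rmodule_def)

lemma abelian_group_HomU:
  assumes M: "pers M" shows "abelian_group (HomU M)"
proof -
  interpret M: pers_module P leq R M by (rule M)
  have ag: "abelian_group (FObj M b)" if "b \<in> P" for b
    using M.FObj_module[OF that] by (simp add: right_module_def)
  show ?thesis
  proof (rule abelian_groupI, goal_cases)
    case (3 \<eta> \<theta> \<zeta>)
    then show ?case
      by (intro hom_U_ext[of _ M _ M])
        (auto simp: HomU_add_closed M hom_U_closed abelian_monoid.a_assoc abelian_group.axioms(1) ag)
  next
    case (4 \<eta> \<theta>)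
    then show ?case
      by (intro hom_U_ext[of _ M _ M])
        (auto simp: HomU_add_closed M hom_U_closed abelian_monoid.a_comm abelian_group.axioms(1) ag)
  next
    case (5 \<eta>)
    then show ?case
      by (intro hom_U_ext[of _ M _ M])
        (auto simp: HomU_add_closed HomU_zero_closed M hom_U_closed abelian_monoid.l_zero
          abelian_group.axioms(1) ag)
  next
    case (6 \<eta>)
    then have \<eta>: "\<eta> \<in> hom_U M" by simp
    define \<theta> where "\<theta> = (\<lambda>b\<in>P. \<lambda>x\<in>carrier (FObj U b). \<ominus>\<^bsub>FObj M b\<^esub> \<eta> b x)"
    have "\<theta> \<in> hom_U M"
      by (rule hom_UI[OF M])
        (auto simp: \<theta>_def carrier_U_mono hom_U_natural[OF M \<eta>] hom_U_closed[OF \<eta>] ag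
          rmod_hom_minus[OF M.FArr_hom] intro!: rmod_hom_neg right_module_U M.FObj_module hom_U_hom[OF \<eta>])
    moreover from this have "\<theta> \<oplus>\<^bsub>HomU M\<^esub> \<eta> = \<zero>\<^bsub>HomU M\<^esub>"
      by (intro hom_U_ext[of _ M _ M])
        (auto simp: HomU_add_closed HomU_zero_closed M \<eta> hom_U_closed[OF \<eta>] abelian_group.l_neg
          ag \<theta>_def)
    ultimately show ?case by auto
  qed (auto simp: HomU_add_closed HomU_zero_closed M)
qed

lemma EndU_one_closed: "\<one>\<^bsub>EndU\<^esub> \<in> hom_U U"
  by (rule hom_UI[OF pers_U])
    (auto simp: FArr_U carrier_U_mono, auto simp: End_ring_def intro!: rmod_hom_id right_module_U)

text \<open>The additive group is borrowed from \<open>HomU U\<close>. Distributivity in the left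
  factor is pointwise; in the right factor it is additivity of the components.\<close>

lemma ring_EndU: "ring EndU"
proof (rule ringI)
  interpret H: abelian_group "HomU U" by (rule abelian_group_HomU[OF pers_U])
  note H = H.a_closed H.zero_closed H.a_assoc H.a_comm H.l_zero
  show "abelian_group EndU"
  proof (rule abelian_groupI)
    fix \<alpha> assume "\<alpha> \<in> carrier EndU"
    then show "\<exists>\<beta> \<in> carrier EndU. \<beta> \<oplus>\<^bsub>EndU\<^esub> \<alpha> = \<zero>\<^bsub>EndU\<^esub>"
      using H.a_inv_closed[of \<alpha>] H.l_neg[of \<alpha>] by (auto simp: EndU_eq_HomU)
  qed (use H in \<open>auto simp: EndU_eq_HomU\<close>)
  show "monoid EndU"
  proof (rule monoidI, goal_cases)
    case (3 \<alpha> \<beta> \<gamma>)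
    then show ?case
      by (intro hom_U_ext[of _ U _ U])
        (auto simp: pmod_comp_hom_U[OF pers_U pers_U] hom_U_closed)
  qed (auto intro!: EndU_one_closed pmod_comp_hom_U[OF pers_U pers_U] hom_U_ext[of _ U _ U]
      simp: hom_U_closed)
qed (auto intro!: EndU_one_closed pmod_comp_hom_U[OF pers_U pers_U] HomU_add_closed[OF pers_U]
      hom_U_ext[of _ U _ U] simp: hom_U_closed EndU_eq_HomU rmod_hom_add[OF hom_U_hom])

lemma right_module_HomU:
  assumes M: "pers M" shows "right_module EndU (HomU M)"
proof (intro right_module.intro right_module_axioms.intro ring_EndU abelian_group_HomU M)
qed (auto intro!: EndU_one_closed pmod_comp_hom_U[OF pers_U] M HomU_add_closed
      pmod_comp_hom_U[OF pers_U pers_U] pers_U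
      hom_U_ext[of _ M _ M] simp: hom_U_closed EndU_eq_HomU rmod_hom_add[OF hom_U_hom])

subsection \<open>The Yoneda correspondence\<close>

text \<open>A single vector stands for the generator of \<open>R[U\<^sub>a]\<close> at all points
  \<open>b \<ge> a\<close>, which is possible because the structure maps of \<open>U\<close> are
  inclusions.\<close>

definition unit_vector :: "'p \<Rightarrow> 'p \<Rightarrow> 'r" (\<open>\<delta>\<close>) where
  "\<delta> a = (\<lambda>i\<in>P. if i = a then \<one> else \<zero>)"

text \<open>Only coordinate \<open>a\<close> of \<open>x\<close> enters, so the map vanishes on the
  summands of \<open>U\<close> other than \<open>R[U\<^sub>a]\<close>. The case distinction is there
  because \<open>M\<close> has no structure map from \<open>a\<close> to \<open>b\<close> unless
  \<open>a \<le> b\<close>.\<close>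

definition yoneda :: "('p, 'r, 'm) pmodule \<Rightarrow> 'p \<Rightarrow> 'm \<Rightarrow> 'p \<Rightarrow> ('p \<Rightarrow> 'r) \<Rightarrow> 'm" where
  "yoneda M a m = (\<lambda>b\<in>P. \<lambda>x\<in>carrier (FObj U b).
     if (a, b) \<in> leq then FArr M a b () m \<star>\<^bsub>FObj M b\<^esub> x a else \<zero>\<^bsub>FObj M b\<^esub>)"

lemma unit_vector_closed:
  "\<lbrakk>a \<in> P; b \<in> P; (a, b) \<in> leq\<rbrakk> \<Longrightarrow> \<delta> a \<in> carrier (FObj U b)"
  by (auto simp: carrier_U unit_vector_def)

lemma unit_vector_self: "a \<in> P \<Longrightarrow> \<delta> a \<in> carrier (FObj U a)"
  by (simp add: unit_vector_closed leq_refl)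

lemma unit_vector_apply: "i \<in> P \<Longrightarrow> \<delta> a i = (if i = a then \<one> else \<zero>)"
  by (simp add: unit_vector_def)

lemma U_ract_closed:
  "\<lbrakk>b \<in> P; x \<in> carrier (FObj U b); r \<in> carrier R\<rbrakk> \<Longrightarrow> x \<star>\<^bsub>FObj U b\<^esub> r \<in> carrier (FObj U b)"
  using right_module.ract_closed[OF right_module_U] by metis

lemma yoneda_hom:
  assumes M: "pers M" and a: "a \<in> P" and m: "m \<in> carrier (FObj M a)"
  shows "yoneda M a m \<in> hom_U M"
proof -
  interpret M: pers_module P leq R M by (rule M)
  have F: "FArr M a b () m \<in> carrier (FObj M b)" if "b \<in> P" "(a, b) \<in> leq" for b
    using rmod_hom_closed[OF M.FArr_hom[OF a that] m] .
  show ?thesis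
  proof (rule hom_UI[OF M])
    fix b assume b: "b \<in> P"
    interpret Mb: right_module R "FObj M b" by (rule M.FObj_module[OF b])
    interpret Ub: right_module R "FObj U b" by (rule right_module_U[OF b])
    show "yoneda M a m b \<in> rmod_hom R (FObj U b) (FObj M b)"
    proof (rule rmod_homI)
      fix x y assume "x \<in> carrier (FObj U b)" "y \<in> carrier (FObj U b)"
      then show "yoneda M a m b (x \<oplus>\<^bsub>FObj U b\<^esub> y) = yoneda M a m b x \<oplus>\<^bsub>FObj M b\<^esub> yoneda M a m b y"
        using a b Ub.M.a_closed[of x y] carrier_U_apply[OF b _ a]
        by (auto simp: yoneda_def U_simps Mb.ract_add_right F)
    next
      fix x r assume "x \<in> carrier (FObj U b)" "r \<in> carrier R"
      then show "yoneda M a m b (x \<star>\<^bsub>FObj U b\<^esub> r) = yoneda M a m b x \<star>\<^bsub>FObj M b\<^esub> r"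
        using a b Ub.ract_closed[of x r] carrier_U_apply[OF b _ a]
        by (auto simp: yoneda_def U_simps Mb.ract_mult F)
    qed (use a b carrier_U_apply[OF b _ a] F in \<open>auto simp: yoneda_def intro: Mb.ract_closed\<close>)
  next
    fix b c x assume h: "b \<in> P" "c \<in> P" "x \<in> carrier (FObj U b)" "(b, c) \<in> leq"
    interpret Mb: right_module R "FObj M b" by (rule M.FObj_module[OF h(1)])
    interpret Mc: right_module R "FObj M c" by (rule M.FObj_module[OF h(2)])
    have h0: "FArr M b c () \<zero>\<^bsub>FObj M b\<^esub> = \<zero>\<^bsub>FObj M c\<^esub>"
      by (rule rmod_hom_zero[OF M.FArr_hom]) (use h Mb.M.abelian_group_axioms Mc.M.abelian_group_axioms in auto)
    show "yoneda M a m c x = FArr M b c () (yoneda M a m b x)"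
    proof (cases "(a, b) \<in> leq")
      case True
      then show ?thesis
        using h a m leq_trans[of a b c] carrier_U_apply[OF h(1,3) a]
        by (simp add: yoneda_def carrier_U_mono rmod_hom_ract[OF M.FArr_hom] F M.FArr_comp)
    next
      \<comment> \<open>Coordinate \<open>a\<close> of \<open>x\<close> is zero here, so both sides
        vanish even if \<open>a\<close> lies below \<open>c\<close>.\<close>
      case False
      then show ?thesis
        using h a carrier_U_zero[OF h(1,3) a] by (auto simp: yoneda_def carrier_U_mono h0 F)
    qed
  qed (simp add: yoneda_def)
qed

lemma yoneda_unit_vector:
  assumes "pers M" "a \<in> P" "m \<in> carrier (FObj M a)" "b \<in> P" "(a, b) \<in> leq"
  shows "yoneda M a m b (\<delta> a) = FArr M a b () m"
proof -
  interpret M: pers_module P leq R M by fact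
  interpret Mb: right_module R "FObj M b" by (rule M.FObj_module) fact
  show ?thesis
    using assms rmod_hom_closed[OF M.FArr_hom[OF assms(2,4,5)]]
    by (simp add: yoneda_def unit_vector_closed unit_vector_apply Mb.ract_one)
qed

lemma yoneda_unit_vector_ract:
  assumes "pers M" "a \<in> P" "m \<in> carrier (FObj M a)" "r \<in> carrier R"
  shows "yoneda M a m a (\<delta> a \<star>\<^bsub>FObj U a\<^esub> r) = m \<star>\<^bsub>FObj M a\<^esub> r"
proof -
  interpret M: pers_module P leq R M by fact
  show ?thesis
    using assms
    by (simp add: rmod_hom_ract[OF hom_U_hom[OF yoneda_hom]] unit_vector_self yoneda_unit_vector
      leq_refl M.FArr_id)
qed

lemma yoneda_unit_vector_self:
  assumes "pers M" "a \<in> P" "m \<in> carrier (FObj M a)"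
  shows "yoneda M a m a (\<delta> a) = m"
  using assms pers_module.FArr_id[of P leq R M] by (simp add: yoneda_unit_vector leq_refl)

text \<open>At \<open>b \<ge> a\<close>, linearity of \<open>\<eta>\<close> pulls out the scalar
  \<open>z a\<close>, and naturality from \<open>a\<close> to \<open>b\<close> identifies what is
  left. At all other points both sides are zero.\<close>

lemma pmod_comp_yoneda:
  assumes M: "pers M" and \<eta>: "\<eta> \<in> hom_U M" and a: "a \<in> P" and x: "x \<in> carrier (FObj U a)"
  shows "pmod_comp P U \<eta> (yoneda U a x) = yoneda M a (\<eta> a x)"
proof (rule hom_U_ext)
  interpret M: pers_module P leq R M by (rule M)
  show yx: "pmod_comp P U \<eta> (yoneda U a x) \<in> hom_U M"
    using assms by (intro pmod_comp_hom_U[OF pers_U] yoneda_hom pers_U)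
  show "yoneda M a (\<eta> a x) \<in> hom_U M"
    by (rule yoneda_hom[OF M a hom_U_closed[OF \<eta> a x]])
  fix b z assume b: "b \<in> P" and z: "z \<in> carrier (FObj U b)"
  interpret Mb: right_module R "FObj M b" by (rule M.FObj_module[OF b])
  interpret Ub: right_module R "FObj U b" by (rule right_module_U[OF b])
  have e0: "\<eta> b \<zero>\<^bsub>FObj U b\<^esub> = \<zero>\<^bsub>FObj M b\<^esub>"
    by (rule rmod_hom_zero[OF hom_U_hom[OF \<eta> b] Ub.M.abelian_group_axioms Mb.M.abelian_group_axioms])
  show "pmod_comp P U \<eta> (yoneda U a x) b z = yoneda M a (\<eta> a x) b z"
    using a b x z e0 hom_U_natural[OF M \<eta> a b x] carrier_U_mono[OF a b _ x] carrier_U_apply[OF b z a]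
    by (auto simp: yoneda_def FArr_U rmod_hom_ract[OF hom_U_hom[OF \<eta> b]])
qed

text \<open>Read as a matrix over \<open>R\<close>, this endomorphism has \<open>x\<close> as its
  column \<open>a\<close> and zeros elsewhere.\<close>

lemma yoneda_U_apply:
  assumes "a \<in> P" "x \<in> carrier (FObj U a)" "b \<in> P" "z \<in> carrier (FObj U b)"
  shows "yoneda U a x b z = (\<lambda>i\<in>P. x i \<otimes> z a)"
  using assms carrier_U_apply[OF assms(1,2)] carrier_U_zero[OF assms(3,4,1)]
  by (auto simp: yoneda_def U_simps FArr_U intro!: restrict_ext)

lemma yoneda_add:
  assumes M: "pers M" and a: "a \<in> P" and m: "m \<in> carrier (FObj M a)" "n \<in> carrier (FObj M a)"
  shows "yoneda M a (m \<oplus>\<^bsub>FObj M a\<^esub> n) = yoneda M a m \<oplus>\<^bsub>HomU M\<^esub> yoneda M a n"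
proof (rule hom_U_ext)
  interpret M: pers_module P leq R M by (rule M)
  interpret Ma: right_module R "FObj M a" by (rule M.FObj_module[OF a])
  show "yoneda M a (m \<oplus>\<^bsub>FObj M a\<^esub> n) \<in> hom_U M"
    using assms by (intro yoneda_hom) auto
  show "yoneda M a m \<oplus>\<^bsub>HomU M\<^esub> yoneda M a n \<in> hom_U M"
    using assms by (intro HomU_add_closed yoneda_hom)
  fix b z assume b: "b \<in> P" and z: "z \<in> carrier (FObj U b)"
  interpret Mb: right_module R "FObj M b" by (rule M.FObj_module[OF b])
  show "yoneda M a (m \<oplus>\<^bsub>FObj M a\<^esub> n) b z = (yoneda M a m \<oplus>\<^bsub>HomU M\<^esub> yoneda M a n) b z"
    using a b m z carrier_U_apply[OF b z a] rmod_hom_closed[OF M.FArr_hom]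
    by (auto simp: yoneda_def rmod_hom_add[OF M.FArr_hom] Mb.ract_add_left)
qed

text \<open>Turns the scalar action on \<open>M a\<close> into right multiplication by an
  endomorphism of \<open>U\<close>, with which every \<open>EndU\<close>-linear map commutes.
  \<open>yoneda_FArr\<close> does the same for the structure maps.\<close>

lemma yoneda_ract:
  assumes M: "pers M" and a: "a \<in> P" and m: "m \<in> carrier (FObj M a)" and r: "r \<in> carrier R"
  shows "yoneda M a (m \<star>\<^bsub>FObj M a\<^esub> r) =
    pmod_comp P U (yoneda M a m) (yoneda U a (\<delta> a \<star>\<^bsub>FObj U a\<^esub> r))"
  using assms
  by (simp add: pmod_comp_yoneda yoneda_hom U_ract_closed unit_vector_self yoneda_unit_vector_ract)

lemma yoneda_FArr:
  assumes M: "pers M" and ab: "a \<in> P" "b \<in> P" "(a, b) \<in> leq" and m: "m \<in> carrier (FObj M a)"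
  shows "yoneda M b (FArr M a b () m) = pmod_comp P U (yoneda M a m) (yoneda U b (\<delta> a))"
  using assms by (simp add: pmod_comp_yoneda yoneda_hom unit_vector_closed yoneda_unit_vector)

section \<open>Full faithfulness of \<open>Hom(U, -)\<close>\<close>

text \<open>Composing with \<open>yoneda M a m\<close> and evaluating at \<open>\<delta> a\<close>
  recovers \<open>\<phi> a m\<close>.\<close>

lemma HomU_faithful:
  assumes M: "pers M" and N: "pers N"
    and \<phi>: "\<phi> \<in> pmod_hom P leq R M N" and \<psi>: "\<psi> \<in> pmod_hom P leq R M N"
    and eq: "\<And>\<eta>. \<eta> \<in> hom_U M \<Longrightarrow> pmod_comp P U \<phi> \<eta> = pmod_comp P U \<psi> \<eta>"
  shows "\<phi> = \<psi>"
proof (rule extensionalityI[where A = P])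
  fix a assume a: "a \<in> P"
  show "\<phi> a = \<psi> a"
  proof (rule extensionalityI[where A = "carrier (FObj M a)"])
    fix m assume m: "m \<in> carrier (FObj M a)"
    then have "pmod_comp P U \<phi> (yoneda M a m) a (\<delta> a) = pmod_comp P U \<psi> (yoneda M a m) a (\<delta> a)"
      using eq M a by (simp add: yoneda_hom)
    then show "\<phi> a m = \<psi> a m"
      using M a m by (simp add: unit_vector_self yoneda_unit_vector_self)
  qed (use \<phi> \<psi> a in \<open>auto simp: pmod_hom_def intro: rmod_hom_extensional\<close>)
qed (use \<phi> \<psi> in \<open>auto simp: pmod_hom_def PiE_iff\<close>)

text \<open>Right multiplication by the endomorphisms \<open>yoneda U a x\<close> encodes scalars,
  structure maps and evaluation at \<open>x\<close>. That \<open>h\<close> commutes with it yields,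
  in this order, linearity of \<open>\<phi>\<close>, its naturality, and agreement with
  \<open>h\<close>.\<close>

lemma HomU_full:
  assumes M: "pers M" and N: "pers N" and h: "h \<in> rmod_hom EndU (HomU M) (HomU N)"
  shows "\<exists>\<phi> \<in> pmod_hom P leq R M N. \<forall>\<eta> \<in> hom_U M. pmod_comp P U \<phi> \<eta> = h \<eta>"
proof -
  interpret M: pers_module P leq R M by (rule M)
  interpret N: pers_module P leq R N by (rule N)
  have h_closed: "\<eta> \<in> hom_U M \<Longrightarrow> h \<eta> \<in> hom_U N" for \<eta>
    using rmod_hom_closed[OF h] by simp
  have h_comp: "h (pmod_comp P U \<eta> \<alpha>) = pmod_comp P U (h \<eta>) \<alpha>"
    if "\<eta> \<in> hom_U M" "\<alpha> \<in> hom_U U" for \<eta> \<alpha>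
    using rmod_hom_ract[OF h, of \<eta> \<alpha>] that by simp
  have yU: "yoneda U a x \<in> hom_U U" if "a \<in> P" "x \<in> carrier (FObj U a)" for a x
    using that by (intro yoneda_hom pers_U)
  define \<phi> where "\<phi> = (\<lambda>a\<in>P. \<lambda>m\<in>carrier (FObj M a). h (yoneda M a m) a (\<delta> a))"
  have \<phi>: "\<phi> a m = h (yoneda M a m) a (\<delta> a)" if "a \<in> P" "m \<in> carrier (FObj M a)" for a m
    using that by (simp add: \<phi>_def)
  have \<phi>_hom: "\<phi> a \<in> rmod_hom R (FObj M a) (FObj N a)" if a: "a \<in> P" for a
  proof -
    interpret Ma: right_module R "FObj M a" by (rule M.FObj_module[OF a])
    show ?thesis
    proof (rule rmod_homI)
      fix m assume "m \<in> carrier (FObj M a)"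
      then show "\<phi> a m \<in> carrier (FObj N a)"
        using hom_U_closed[OF h_closed[OF yoneda_hom[OF M a]] a unit_vector_self[OF a]] a
        by (simp add: \<phi>)
    next
      fix m assume "m \<notin> carrier (FObj M a)"
      then show "\<phi> a m = undefined" using a by (simp add: \<phi>_def)
    next
      fix m n assume "m \<in> carrier (FObj M a)" "n \<in> carrier (FObj M a)"
      then show "\<phi> a (m \<oplus>\<^bsub>FObj M a\<^esub> n) = \<phi> a m \<oplus>\<^bsub>FObj N a\<^esub> \<phi> a n"
        using a M by (simp add: \<phi> yoneda_add rmod_hom_add[OF h] yoneda_hom unit_vector_self)
    next
      fix m r assume "m \<in> carrier (FObj M a)" "r \<in> carrier R"
      then show "\<phi> a (m \<star>\<^bsub>FObj M a\<^esub> r) = \<phi> a m \<star>\<^bsub>FObj N a\<^esub> r"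
        using a M N
        by (simp add: \<phi> Ma.ract_closed yoneda_ract h_comp yoneda_hom unit_vector_self yU U_ract_closed
          yoneda_unit_vector_ract[OF pers_U] yoneda_unit_vector_self[OF pers_U]
          rmod_hom_ract[OF hom_U_hom[OF h_closed]])
    qed
  qed
  \<comment> \<open>Both sides equal \<open>h (yoneda M a m) b (\<delta> a)\<close>: the left one by
    \<open>yoneda_FArr\<close> and linearity of \<open>h\<close>, the right one by naturality of
    \<open>h (yoneda M a m)\<close>.\<close>
  have \<phi>_natural: "\<phi> b (FArr M a b () m) = FArr N a b () (\<phi> a m)"
    if ab: "a \<in> P" "b \<in> P" "(a, b) \<in> leq" and m: "m \<in> carrier (FObj M a)" for a b m
    using ab m M rmod_hom_closed[OF M.FArr_hom[OF ab] m]
      hom_U_natural[OF N h_closed[OF yoneda_hom[OF M ab(1) m]] ab(1,2) unit_vector_self[OF ab(1)] ab(3)]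
    by (simp add: \<phi> yoneda_FArr h_comp yoneda_hom unit_vector_self unit_vector_closed yU
      yoneda_unit_vector_self[OF pers_U])
  have "\<phi> \<in> pmod_hom P leq R M N"
    using \<phi>_hom \<phi>_natural rmod_hom_closed[OF M.FArr_hom]
    by (auto simp: pmod_hom_def compose_eq_iff) (simp add: \<phi>_def)
  moreover have "pmod_comp P U \<phi> \<eta> = h \<eta>" if \<eta>: "\<eta> \<in> hom_U M" for \<eta>
  proof (rule hom_U_ext)
    show "pmod_comp P U \<phi> \<eta> \<in> hom_U N"
      using \<open>\<phi> \<in> pmod_hom P leq R M N\<close> \<eta> M N by (intro pmod_comp_hom_U)
    show "h \<eta> \<in> hom_U N" using h_closed \<eta> .
    fix b x assume "b \<in> P" "x \<in> carrier (FObj U b)"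
    \<comment> \<open>The element \<open>\<eta> b x\<close> corresponds to
      \<open>\<eta> \<circ> yoneda U b x\<close>, which \<open>h\<close> sends to
      \<open>h \<eta> \<circ> yoneda U b x\<close>; its value at \<open>\<delta> b\<close> is
      \<open>h \<eta> b x\<close>.\<close>
    then show "pmod_comp P U \<phi> \<eta> b x = h \<eta> b x"
      using \<eta> M
      by (simp add: \<phi> hom_U_closed pmod_comp_yoneda[symmetric] h_comp yU unit_vector_self
        yoneda_unit_vector_self[OF pers_U])
  qed
  ultimately show ?thesis by blast
qed

subsection \<open>Modules over the endomorphism ring\<close>

abbreviation idem :: "'p \<Rightarrow> 'p \<Rightarrow> ('p \<Rightarrow> 'r) \<Rightarrow> 'p \<Rightarrow> 'r" (\<open>\<epsilon>\<close>) where
  "\<epsilon> a \<equiv> yoneda U a (\<delta> a)"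

lemma yoneda_U_closed: "\<lbrakk>a \<in> P; x \<in> carrier (FObj U a)\<rbrakk> \<Longrightarrow> yoneda U a x \<in> hom_U U"
  by (rule yoneda_hom[OF pers_U])

lemma idem_closed: "a \<in> P \<Longrightarrow> \<epsilon> a \<in> hom_U U"
  by (simp add: yoneda_U_closed unit_vector_self)

lemma yoneda_U_unit_vector:
  "\<lbrakk>b \<in> P; x \<in> carrier (FObj U b); c \<in> P; (b, c) \<in> leq\<rbrakk> \<Longrightarrow> yoneda U b x c (\<delta> b) = x"
  by (simp add: yoneda_unit_vector[OF pers_U] FArr_U)

text \<open>Applying \<open>\<epsilon> b\<close> leaves only coordinate \<open>b\<close> of a
  vector, whereas \<open>\<epsilon> a\<close> reads coordinate \<open>a\<close>, which is then
  zero.\<close>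

lemma idem_orthogonal:
  assumes "a \<in> P" "b \<in> P" "a \<noteq> b"
  shows "pmod_comp P U (\<epsilon> a) (\<epsilon> b) = \<zero>\<^bsub>EndU\<^esub>"
proof (rule hom_U_ext)
  show "pmod_comp P U (\<epsilon> a) (\<epsilon> b) \<in> hom_U U"
    using assms by (intro pmod_comp_hom_U[OF pers_U pers_U] idem_closed)
  show "\<zero>\<^bsub>EndU\<^esub> \<in> hom_U U"
    by (simp add: EndU_eq_HomU HomU_zero_closed pers_U)
  fix c x assume "c \<in> P" "x \<in> carrier (FObj U c)"
  then show "pmod_comp P U (\<epsilon> a) (\<epsilon> b) c x = \<zero>\<^bsub>EndU\<^esub> c x"
    using assms hom_U_closed[OF idem_closed] carrier_U_apply[of c x]
    by (auto simp: yoneda_U_apply unit_vector_self EndU_eq_HomU U_simps unit_vector_apply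
      intro!: restrict_ext)
qed

section \<open>Decomposition of \<open>End(U)\<close>-modules along the idempotents\<close>

text \<open>The partial sum of the idempotents \<open>\<epsilon> a\<close> over
  \<open>a \<in> S\<close>, in closed form: for \<open>S = P\<close> it is visibly the identity, and
  adding one index adds one idempotent.\<close>

definition coord_proj :: "'p set \<Rightarrow> 'p \<Rightarrow> ('p \<Rightarrow> 'r) \<Rightarrow> 'p \<Rightarrow> 'r" where
  "coord_proj S = (\<lambda>b\<in>P. \<lambda>x\<in>carrier (FObj U b). \<lambda>i\<in>P. if i \<in> S then x i else \<zero>)"

lemma coord_proj_empty: "coord_proj {} = \<zero>\<^bsub>EndU\<^esub>"
  by (auto simp: coord_proj_def End_ring_def U_simps)

lemma coord_proj_full: "coord_proj P = \<one>\<^bsub>EndU\<^esub>"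
  unfolding coord_proj_def End_ring_def
  by (auto simp: carrier_U PiE_iff extensional_def intro!: restrict_ext)

lemma coord_proj_insert:
  assumes "a \<in> P" "a \<notin> S"
  shows "coord_proj (insert a S) = coord_proj S \<oplus>\<^bsub>EndU\<^esub> \<epsilon> a"
  using assms carrier_U_apply
  by (auto simp: coord_proj_def End_ring_def U_simps yoneda_U_apply unit_vector_self
    unit_vector_apply intro!: restrict_ext)

lemma coord_proj_closed:
  assumes "finite S" "S \<subseteq> P"
  shows "coord_proj S \<in> hom_U U"
  using assms
proof (induction S)
  case empty
  then show ?case by (simp add: coord_proj_empty EndU_eq_HomU HomU_zero_closed pers_U)
next
  case (insert a S)
  then show ?case
    by (simp add: coord_proj_insert EndU_eq_HomU HomU_add_closed pers_U idem_closed)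
qed

text \<open>As the idempotents sum to the identity, \<open>n\<close> is the sum of its components
  \<open>n \<star> \<epsilon> a\<close>. Induction over \<open>coord_proj S\<close> expresses this
  without an explicit finite sum.\<close>

lemma EndU_module_separated:
  assumes N: "right_module EndU N" and n: "n \<in> carrier N" "n' \<in> carrier N"
    and eq: "\<And>a. a \<in> P \<Longrightarrow> n \<star>\<^bsub>N\<^esub> \<epsilon> a = n' \<star>\<^bsub>N\<^esub> \<epsilon> a"
  shows "n = n'"
proof -
  interpret N: right_module EndU N by (rule N)
  have "n \<star>\<^bsub>N\<^esub> coord_proj S = n' \<star>\<^bsub>N\<^esub> coord_proj S" if "S \<subseteq> P" for S
    using finite_subset[OF that finite_P] that
  proof (induction S)
    case empty
    then show ?case using n by (simp add: coord_proj_empty)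
  next
    case (insert a S)
    then show ?case
      using n eq by (simp add: coord_proj_insert N.ract_add_right coord_proj_closed idem_closed)
  qed
  from this[of P] show ?thesis
    using n by (simp add: coord_proj_full N.ract_one)
qed

text \<open>The element sought is the sum of the \<open>m a\<close>. Since
  \<open>m b = m b \<star> \<epsilon> b\<close>, orthogonality kills its components at all other
  points, so in the induction the partial sum over \<open>S\<close> has component zero outside
  \<open>S\<close>.\<close>

lemma EndU_module_glue:
  assumes N: "right_module EndU N"
    and m: "\<And>a. a \<in> P \<Longrightarrow> m a \<in> carrier N" "\<And>a. a \<in> P \<Longrightarrow> m a \<star>\<^bsub>N\<^esub> \<epsilon> a = m a"
  shows "\<exists>n\<in>carrier N. \<forall>a\<in>P. n \<star>\<^bsub>N\<^esub> \<epsilon> a = m a"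
proof -
  interpret N: right_module EndU N by (rule N)
  have orth: "m b \<star>\<^bsub>N\<^esub> \<epsilon> a = \<zero>\<^bsub>N\<^esub>" if "a \<in> P" "b \<in> P" "a \<noteq> b" for a b
    using N.ract_mult[of "m b" "\<epsilon> b" "\<epsilon> a"] that m by (simp add: idem_closed idem_orthogonal)
  have "\<exists>n\<in>carrier N. \<forall>a\<in>P. n \<star>\<^bsub>N\<^esub> \<epsilon> a = (if a \<in> S then m a else \<zero>\<^bsub>N\<^esub>)" if "S \<subseteq> P" for S
    using finite_subset[OF that finite_P] that
  proof (induction S)
    case empty
    then show ?case by (intro bexI[of _ "\<zero>\<^bsub>N\<^esub>"]) (auto simp: idem_closed)
  next
    case (insert b S)
    then obtain n where n: "n \<in> carrier N"
      "\<And>a. a \<in> P \<Longrightarrow> n \<star>\<^bsub>N\<^esub> \<epsilon> a = (if a \<in> S then m a else \<zero>\<^bsub>N\<^esub>)"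
      by auto
    have "(n \<oplus>\<^bsub>N\<^esub> m b) \<star>\<^bsub>N\<^esub> \<epsilon> a = (if a \<in> insert b S then m a else \<zero>\<^bsub>N\<^esub>)" if "a \<in> P" for a
      using that insert.hyps insert.prems n m orth[of a b]
      by (cases "a = b") (auto simp: N.ract_add_left idem_closed)
    then show ?case
      using insert.prems n m by (intro bexI[of _ "n \<oplus>\<^bsub>N\<^esub> m b"]) auto
  qed
  from this[of P] show ?thesis by simp
qed

section \<open>The persistence module of a right \<open>End(U)\<close>-module\<close>

text \<open>The space \<open>N \<epsilon> b\<close> is given as the fixed points of the idempotent
  \<open>\<epsilon> b\<close>. As matrices, the endomorphism in the scalar action has the single
  entry \<open>r\<close> at \<open>(b, b)\<close>, and the one in the structure map has the single
  entry \<open>1\<close> in row \<open>b\<close> and column \<open>c\<close>.\<close>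

definition corner ::
  "('p \<Rightarrow> ('p \<Rightarrow> 'r) \<Rightarrow> 'p \<Rightarrow> 'r, 'n) rmodule \<Rightarrow> ('p, 'r, 'n) pmodule" where
  "corner N = \<lparr>
     FObj = (\<lambda>b. \<lparr>carrier = {n \<in> carrier N. n \<star>\<^bsub>N\<^esub> \<epsilon> b = n}, mult = undefined, one = undefined,
       zero = \<zero>\<^bsub>N\<^esub>, add = (\<oplus>\<^bsub>N\<^esub>),
       ract = (\<lambda>n r. n \<star>\<^bsub>N\<^esub> yoneda U b (\<delta> b \<star>\<^bsub>FObj U b\<^esub> r))\<rparr>),
     FArr = (\<lambda>b c u. \<lambda>n\<in>{n \<in> carrier N. n \<star>\<^bsub>N\<^esub> \<epsilon> b = n}. n \<star>\<^bsub>N\<^esub> yoneda U c (\<delta> b))\<rparr>"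

lemma corner_simps [simp]:
  "n \<in> carrier (FObj (corner N) b) \<longleftrightarrow> n \<in> carrier N \<and> n \<star>\<^bsub>N\<^esub> \<epsilon> b = n"
  "\<zero>\<^bsub>FObj (corner N) b\<^esub> = \<zero>\<^bsub>N\<^esub>"
  "m \<oplus>\<^bsub>FObj (corner N) b\<^esub> n = m \<oplus>\<^bsub>N\<^esub> n"
  "n \<star>\<^bsub>FObj (corner N) b\<^esub> r = n \<star>\<^bsub>N\<^esub> yoneda U b (\<delta> b \<star>\<^bsub>FObj U b\<^esub> r)"
  by (simp_all add: corner_def)

lemma FArr_corner:
  "\<lbrakk>n \<in> carrier N; n \<star>\<^bsub>N\<^esub> \<epsilon> b = n\<rbrakk> \<Longrightarrow> FArr (corner N) b c u n = n \<star>\<^bsub>N\<^esub> yoneda U c (\<delta> b)"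
  by (simp add: corner_def)

text \<open>Two successive actions merge by associativity and \<open>pmod_comp_yoneda\<close>. The
  multiplicative laws of \<open>corner N\<close> thereby become identities between vectors of
  \<open>U\<close>.\<close>

lemma EndU_module_ract_yoneda:
  assumes N: "right_module EndU N" and n: "n \<in> carrier N"
    and b: "b \<in> P" "x \<in> carrier (FObj U b)" and c: "c \<in> P" "z \<in> carrier (FObj U c)"
  shows "n \<star>\<^bsub>N\<^esub> yoneda U b x \<star>\<^bsub>N\<^esub> yoneda U c z = n \<star>\<^bsub>N\<^esub> yoneda U c (yoneda U b x c z)"
  using right_module.ract_mult[OF N n, of "yoneda U b x" "yoneda U c z"] assms
  by (simp add: yoneda_U_closed pmod_comp_yoneda[OF pers_U])

lemma yoneda_U_unit_vector_ract:
  "\<lbrakk>b \<in> P; x \<in> carrier (FObj U b); r \<in> carrier R\<rbrakk>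
    \<Longrightarrow> yoneda U b x b (\<delta> b \<star>\<^bsub>FObj U b\<^esub> r) = x \<star>\<^bsub>FObj U b\<^esub> r"
  by (simp add: yoneda_unit_vector_ract pers_U)

text \<open>Because \<open>yoneda U b x \<circ> \<epsilon> b = yoneda U b x\<close>, acting by this
  endomorphism ends among the fixed points of \<open>\<epsilon> b\<close>.\<close>

lemma corner_closed:
  assumes N: "right_module EndU N" and n: "n \<in> carrier N" and b: "b \<in> P" "x \<in> carrier (FObj U b)"
  shows "n \<star>\<^bsub>N\<^esub> yoneda U b x \<in> carrier (FObj (corner N) b)"
  using right_module.ract_closed[OF N n, of "yoneda U b x"] assms
  by (simp add: yoneda_U_closed EndU_module_ract_yoneda unit_vector_self yoneda_U_unit_vector leq_refl)

lemma pers_corner: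
  assumes N: "right_module EndU N"
  shows "pers (corner N)"
proof (rule pers_module.intro)
  interpret N: right_module EndU N by (rule N)
  note ry = EndU_module_ract_yoneda[OF N]
  note uc = unit_vector_closed unit_vector_self U_ract_closed
  have cl: "n \<star>\<^bsub>N\<^esub> yoneda U b x \<in> carrier N" if "n \<in> carrier N" "b \<in> P" "x \<in> carrier (FObj U b)" for n b x
    using that by (simp add: N.ract_closed yoneda_U_closed)
  fix b assume b: "b \<in> P"
  have ag: "abelian_group (FObj (corner N) b)"
  proof (rule abelian_groupI)
    fix n assume "n \<in> carrier (FObj (corner N) b)"
    then show "\<exists>m\<in>carrier (FObj (corner N) b). m \<oplus>\<^bsub>FObj (corner N) b\<^esub> n = \<zero>\<^bsub>FObj (corner N) b\<^esub>"
      using b by (intro bexI[of _ "\<ominus>\<^bsub>N\<^esub> n"]) (auto simp: N.M.l_neg N.ract_minus idem_closed)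
  qed (use b in \<open>auto simp: N.ract_add_left idem_closed N.M.a_ac\<close>)
  show "right_module R (FObj (corner N) b)"
  proof (intro right_module.intro right_module_axioms.intro R.ring_axioms ag, goal_cases)
    case (1 n r)
    then show ?case
      using b corner_closed[OF N, of n b "\<delta> b \<star>\<^bsub>FObj U b\<^esub> r"] by (simp add: uc)
  next
    case (3 n r s)
    interpret Ub: right_module R "FObj U b" by (rule right_module_U[OF b])
    show ?case
      using 3 b
      by (simp add: Ub.ract_add_right uc yoneda_add[OF pers_U] EndU_eq_HomU[symmetric]
        N.ract_add_right yoneda_U_closed)
  next
    case (4 n r s)
    interpret Ub: right_module R "FObj U b" by (rule right_module_U[OF b])
    show ?case
      using 4 b by (simp add: ry uc yoneda_U_unit_vector_ract Ub.ract_mult)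
  next
    case (5 n)
    interpret Ub: right_module R "FObj U b" by (rule right_module_U[OF b])
    show ?case
      using 5 b by (simp add: Ub.ract_one uc)
  qed (use b in \<open>simp add: N.ract_add_left yoneda_U_closed uc\<close>)
  fix n assume n: "n \<in> carrier (FObj (corner N) b)"
  then show "FArr (corner N) b b () n = n" by (simp add: FArr_corner)
next
  interpret N: right_module EndU N by (rule N)
  note ry = EndU_module_ract_yoneda[OF N]
  note uc = unit_vector_closed unit_vector_self U_ract_closed
  fix b c assume bc: "b \<in> P" "c \<in> P" "(b, c) \<in> leq"
  show "FArr (corner N) b c () \<in> rmod_hom R (FObj (corner N) b) (FObj (corner N) c)"
  proof (rule rmod_homI)
    fix n assume "n \<in> carrier (FObj (corner N) b)"
    then show "FArr (corner N) b c () n \<in> carrier (FObj (corner N) c)"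
      using corner_closed[OF N, of n c "\<delta> b"] bc by (simp add: FArr_corner uc)
  next
    fix n assume "n \<notin> carrier (FObj (corner N) b)"
    then show "FArr (corner N) b c () n = undefined" by (auto simp: corner_def)
  next
    fix m n assume "m \<in> carrier (FObj (corner N) b)" "n \<in> carrier (FObj (corner N) b)"
    then show "FArr (corner N) b c () (m \<oplus>\<^bsub>FObj (corner N) b\<^esub> n) =
        FArr (corner N) b c () m \<oplus>\<^bsub>FObj (corner N) c\<^esub> FArr (corner N) b c () n"
      using bc by (simp add: FArr_corner N.ract_add_left idem_closed yoneda_U_closed uc)
  next
    fix n r assume n: "n \<in> carrier (FObj (corner N) b)" and r: "r \<in> carrier R"
    \<comment> \<open>Scaling at \<open>b\<close> before the structure map and scaling at
      \<open>c\<close> after it both amount to acting by the endomorphism at \<open>c\<close> of the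
      same vector, the one with entry \<open>r\<close> at \<open>b\<close>.\<close>
    have "yoneda U b (\<delta> b \<star>\<^bsub>FObj U b\<^esub> r) c (\<delta> b) = \<delta> b \<star>\<^bsub>FObj U b\<^esub> r"
      using bc r by (simp add: yoneda_U_unit_vector uc)
    moreover have "yoneda U c (\<delta> b) c (\<delta> c \<star>\<^bsub>FObj U c\<^esub> r) = \<delta> b \<star>\<^bsub>FObj U b\<^esub> r"
      using bc r by (simp add: yoneda_U_unit_vector_ract uc) (simp add: U_simps)
    ultimately show "FArr (corner N) b c () (n \<star>\<^bsub>FObj (corner N) b\<^esub> r) =
        FArr (corner N) b c () n \<star>\<^bsub>FObj (corner N) c\<^esub> r"
      using bc n r corner_closed[OF N, of n b "\<delta> b \<star>\<^bsub>FObj U b\<^esub> r"]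
      by (simp add: FArr_corner uc ry)
  qed
next
  interpret N: right_module EndU N by (rule N)
  note ry = EndU_module_ract_yoneda[OF N]
  fix a b c n assume h: "a \<in> P" "b \<in> P" "c \<in> P" "(a, b) \<in> leq" "(b, c) \<in> leq"
    "n \<in> carrier (FObj (corner N) a)"
  then show "FArr (corner N) b c () (FArr (corner N) a b () n) = FArr (corner N) a c () n"
    using corner_closed[OF N, of n b "\<delta> a"]
    by (simp add: FArr_corner unit_vector_closed ry yoneda_U_unit_vector)
qed

section \<open>The comparison map from a module to its \<open>Hom\<close>-module\<close>

text \<open>The element \<open>n\<close> is sent to its action on the endomorphisms
  \<open>yoneda U b x\<close>, regarded as a function of the vector \<open>x\<close>;
  \<open>j\<close> moves the values to the element type wanted for the persistence module.\<close>

definition corner_hom ::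
  "('n \<Rightarrow> 'm) \<Rightarrow> ('p \<Rightarrow> ('p \<Rightarrow> 'r) \<Rightarrow> 'p \<Rightarrow> 'r, 'n) rmodule \<Rightarrow> 'n \<Rightarrow> 'p \<Rightarrow> ('p \<Rightarrow> 'r) \<Rightarrow> 'm" where
  "corner_hom j N n = (\<lambda>b\<in>P. \<lambda>x\<in>carrier (FObj U b). j (n \<star>\<^bsub>N\<^esub> yoneda U b x))"

lemma inj_on_corner: "inj_on j (carrier N) \<Longrightarrow> inj_on j (carrier (FObj (corner N) b))"
  by (auto simp: inj_on_def)

text \<open>Linearity in \<open>x\<close> comes from \<open>yoneda_add\<close> and from merging two
  actions into one. Naturality holds because \<open>yoneda U b x\<close> takes
  \<open>\<delta> b\<close> to \<open>x\<close> at every \<open>c \<ge> b\<close>.\<close>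

lemma corner_hom_closed:
  assumes N: "right_module EndU N" and j: "inj_on j (carrier N)" and n: "n \<in> carrier N"
  shows "corner_hom j N n \<in> hom_U (pmod_image j (corner N))"
proof (rule hom_UI)
  interpret N: right_module EndU N by (rule N)
  show "pers (pmod_image j (corner N))"
    using N j by (intro pers_module_image pers_corner inj_on_corner)
  note jc = inj_on_corner[OF j] corner_closed[OF N n]
  fix b assume b: "b \<in> P"
  interpret Ub: right_module R "FObj U b" by (rule right_module_U[OF b])
  show "corner_hom j N n b \<in> rmod_hom R (FObj U b) (FObj (pmod_image j (corner N)) b)"
  proof (rule rmod_homI)
    fix x assume "x \<in> carrier (FObj U b)"
    then show "corner_hom j N n b x \<in> carrier (FObj (pmod_image j (corner N)) b)"
      using b jc(2) by (simp add: corner_hom_def del: corner_simps)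
  next
    fix x y assume "x \<in> carrier (FObj U b)" "y \<in> carrier (FObj U b)"
    then show "corner_hom j N n b (x \<oplus>\<^bsub>FObj U b\<^esub> y) =
        corner_hom j N n b x \<oplus>\<^bsub>FObj (pmod_image j (corner N)) b\<^esub> corner_hom j N n b y"
      using b n jc
      by (simp add: corner_hom_def yoneda_add[OF pers_U] EndU_eq_HomU[symmetric]
        N.ract_add_right yoneda_U_closed del: corner_simps(1))
  next
    fix x r assume "x \<in> carrier (FObj U b)" "r \<in> carrier R"
    then show "corner_hom j N n b (x \<star>\<^bsub>FObj U b\<^esub> r) =
        corner_hom j N n b x \<star>\<^bsub>FObj (pmod_image j (corner N)) b\<^esub> r"
      using b n jc
      by (simp add: corner_hom_def U_ract_closed unit_vector_self EndU_module_ract_yoneda[OF N]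
        yoneda_U_unit_vector_ract del: corner_simps(1))
  qed (use b in \<open>simp add: corner_hom_def\<close>)
next
  fix b c x assume h: "b \<in> P" "c \<in> P" "x \<in> carrier (FObj U b)" "(b, c) \<in> leq"
  note cc = corner_closed[OF N n h(1,3)]
  then have "FArr (pmod_image j (corner N)) b c () (j (n \<star>\<^bsub>N\<^esub> yoneda U b x)) =
      j (n \<star>\<^bsub>N\<^esub> yoneda U b x \<star>\<^bsub>N\<^esub> yoneda U c (\<delta> b))"
    using inj_on_corner[OF j] by (subst FArr_pmod_image) (auto simp: FArr_corner)
  then show "corner_hom j N n c x = FArr (pmod_image j (corner N)) b c () (corner_hom j N n b x)"
    using h n by (simp add: corner_hom_def carrier_U_mono EndU_module_ract_yoneda[OF N]
      unit_vector_closed yoneda_U_unit_vector)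
qed (simp add: corner_hom_def)

text \<open>Linearity over \<open>EndU\<close> is associativity of the action combined with
  \<open>\<alpha> \<circ> yoneda U b x = yoneda U b (\<alpha> b x)\<close>.\<close>

lemma corner_hom_rmod_hom:
  assumes N: "right_module EndU N" and j: "inj_on j (carrier N)"
  shows "(\<lambda>n\<in>carrier N. corner_hom j N n) \<in> rmod_hom EndU N (HomU (pmod_image j (corner N)))"
    (is "_ \<in> rmod_hom EndU N (HomU ?M)")
proof (rule rmod_homI)
  interpret N: right_module EndU N by (rule N)
  have M: "pers ?M"
    using N j by (intro pers_module_image pers_corner inj_on_corner)
  note cl = corner_hom_closed[OF N j]
  show "(\<lambda>n\<in>carrier N. corner_hom j N n) n \<in> carrier (HomU ?M)" if "n \<in> carrier N" for n
    using that cl by simp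
  fix n assume n: "n \<in> carrier N"
  {
    fix m assume m: "m \<in> carrier N"
    have "corner_hom j N (n \<oplus>\<^bsub>N\<^esub> m) = corner_hom j N n \<oplus>\<^bsub>HomU ?M\<^esub> corner_hom j N m"
    proof (rule hom_U_ext)
      fix b x assume "b \<in> P" "x \<in> carrier (FObj U b)"
      then show "corner_hom j N (n \<oplus>\<^bsub>N\<^esub> m) b x = (corner_hom j N n \<oplus>\<^bsub>HomU ?M\<^esub> corner_hom j N m) b x"
        using n m corner_closed[OF N] inj_on_corner[OF j]
        by (simp add: corner_hom_def N.ract_add_left yoneda_U_closed del: corner_simps(1))
    qed (use n m in \<open>auto intro: cl HomU_add_closed M\<close>)
    then show "(\<lambda>n\<in>carrier N. corner_hom j N n) (n \<oplus>\<^bsub>N\<^esub> m) =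
        (\<lambda>n\<in>carrier N. corner_hom j N n) n \<oplus>\<^bsub>HomU ?M\<^esub> (\<lambda>n\<in>carrier N. corner_hom j N n) m"
      using n m by simp
  }
  fix \<alpha> assume "\<alpha> \<in> carrier EndU"
  then have \<alpha>: "\<alpha> \<in> hom_U U" by simp
  have n\<alpha>: "n \<star>\<^bsub>N\<^esub> \<alpha> \<in> carrier N" using n \<alpha> by (simp add: N.ract_closed)
  have "corner_hom j N (n \<star>\<^bsub>N\<^esub> \<alpha>) = pmod_comp P U (corner_hom j N n) \<alpha>"
  proof (rule hom_U_ext)
    fix b x assume b: "b \<in> P" "x \<in> carrier (FObj U b)"
    then have "n \<star>\<^bsub>N\<^esub> \<alpha> \<star>\<^bsub>N\<^esub> yoneda U b x = n \<star>\<^bsub>N\<^esub> yoneda U b (\<alpha> b x)"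
      using N.ract_mult[of n \<alpha> "yoneda U b x"] n \<alpha>
      by (simp add: yoneda_U_closed pmod_comp_yoneda[OF pers_U])
    then show "corner_hom j N (n \<star>\<^bsub>N\<^esub> \<alpha>) b x = pmod_comp P U (corner_hom j N n) \<alpha> b x"
      using b hom_U_closed[OF \<alpha>] by (simp add: corner_hom_def)
  qed (use n n\<alpha> \<alpha> in \<open>auto intro: cl pmod_comp_hom_U[OF pers_U M]\<close>)
  then show "(\<lambda>n\<in>carrier N. corner_hom j N n) (n \<star>\<^bsub>N\<^esub> \<alpha>) =
      (\<lambda>n\<in>carrier N. corner_hom j N n) n \<star>\<^bsub>HomU ?M\<^esub> \<alpha>"
    using n n\<alpha> by simp
qed simp

text \<open>\<open>HomU M\<close> is an \<open>EndU\<close>-module, so the idempotents separate its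
  elements, and \<open>\<eta> \<circ> \<epsilon> a\<close> depends only on
  \<open>\<eta> a (\<delta> a)\<close>.\<close>

lemma HomU_eqI:
  assumes M: "pers M" and "\<eta> \<in> hom_U M" "\<theta> \<in> hom_U M" "\<And>a. a \<in> P \<Longrightarrow> \<eta> a (\<delta> a) = \<theta> a (\<delta> a)"
  shows "\<eta> = \<theta>"
proof (rule EndU_module_separated[OF right_module_HomU[OF M]])
  fix a assume "a \<in> P"
  then show "\<eta> \<star>\<^bsub>HomU M\<^esub> \<epsilon> a = \<theta> \<star>\<^bsub>HomU M\<^esub> \<epsilon> a"
    using assms by (simp add: pmod_comp_yoneda unit_vector_self)
qed (use assms in auto)

text \<open>The value at \<open>\<delta> a\<close> is the image under \<open>j\<close> of the
  component \<open>n \<star> \<epsilon> a\<close>. Hence injectivity is the separation of elements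
  by components, and surjectivity is the gluing of the components that the values
  \<open>\<eta> a (\<delta> a)\<close> prescribe.\<close>

lemma corner_hom_bij:
  assumes N: "right_module EndU N" and j: "inj_on j (carrier N)"
  shows "bij_betw (\<lambda>n\<in>carrier N. corner_hom j N n) (carrier N)
    (carrier (HomU (pmod_image j (corner N))))" (is "bij_betw _ _ (carrier (HomU ?M))")
  unfolding bij_betw_def
proof
  interpret N: right_module EndU N by (rule N)
  have M: "pers ?M"
    using N j by (intro pers_module_image pers_corner inj_on_corner)
  have delta: "corner_hom j N n a (\<delta> a) = j (n \<star>\<^bsub>N\<^esub> \<epsilon> a)" if "a \<in> P" for n a
    using that by (simp add: corner_hom_def unit_vector_self)
  show "inj_on (\<lambda>n\<in>carrier N. corner_hom j N n) (carrier N)"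
  proof (rule inj_onI)
    fix n n' assume n: "n \<in> carrier N" "n' \<in> carrier N"
      and "(\<lambda>n\<in>carrier N. corner_hom j N n) n = (\<lambda>n\<in>carrier N. corner_hom j N n) n'"
    then have "j (n \<star>\<^bsub>N\<^esub> \<epsilon> a) = j (n' \<star>\<^bsub>N\<^esub> \<epsilon> a)" if "a \<in> P" for a
      using delta[OF that] by simp metis
    then have "n \<star>\<^bsub>N\<^esub> \<epsilon> a = n' \<star>\<^bsub>N\<^esub> \<epsilon> a" if "a \<in> P" for a
      using that n by (intro inj_onD[OF j]) (auto intro!: N.ract_closed simp: idem_closed)
    then show "n = n'" by (rule EndU_module_separated[OF N n])
  qed
  show "(\<lambda>n\<in>carrier N. corner_hom j N n) ` carrier N = carrier (HomU ?M)"
  proof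
    show "(\<lambda>n\<in>carrier N. corner_hom j N n) ` carrier N \<subseteq> carrier (HomU ?M)"
      using corner_hom_closed[OF N j] by auto
    show "carrier (HomU ?M) \<subseteq> (\<lambda>n\<in>carrier N. corner_hom j N n) ` carrier N"
    proof
      fix \<eta> assume "\<eta> \<in> carrier (HomU ?M)"
      then have \<eta>: "\<eta> \<in> hom_U ?M" by simp
      have "\<exists>m. m \<in> carrier N \<and> m \<star>\<^bsub>N\<^esub> \<epsilon> a = m \<and> j m = \<eta> a (\<delta> a)" if "a \<in> P" for a
        using hom_U_closed[OF \<eta> that unit_vector_self[OF that]] by auto
      then obtain m where m: "\<And>a. a \<in> P \<Longrightarrow> m a \<in> carrier N"
        "\<And>a. a \<in> P \<Longrightarrow> m a \<star>\<^bsub>N\<^esub> \<epsilon> a = m a" "\<And>a. a \<in> P \<Longrightarrow> j (m a) = \<eta> a (\<delta> a)"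
        by metis
      obtain n where n: "n \<in> carrier N" "\<And>a. a \<in> P \<Longrightarrow> n \<star>\<^bsub>N\<^esub> \<epsilon> a = m a"
        using EndU_module_glue[OF N m(1,2)] by auto
      have "corner_hom j N n = \<eta>"
        using M corner_hom_closed[OF N j n(1)] \<eta> by (rule HomU_eqI) (simp add: delta n m)
      then show "\<eta> \<in> (\<lambda>n\<in>carrier N. corner_hom j N n) ` carrier N"
        using n by force
    qed
  qed
qed

section \<open>Smallness, functoriality and essential surjectivity of
  \<open>Hom(U, -)\<close>\<close>

text \<open>Evaluation at the generators \<open>\<delta> a\<close> embeds the homomorphisms into a
  finite product of the small sets \<open>M a\<close>.\<close>

lemma card_hom_U:
  assumes M: "pers M" and \<kappa>: "Card_order \<kappa>" "infinite (Field \<kappa>)"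
    and small: "\<And>b. b \<in> P \<Longrightarrow> |carrier (FObj M b)| <o \<kappa>"
  shows "|hom_U M| <o \<kappa>"
proof -
  have "|hom_U M| \<le>o |\<Pi>\<^sub>E a\<in>P. carrier (FObj M a)|"
  proof (rule card_of_ordLeqI)
    show "inj_on (\<lambda>\<eta>. \<lambda>a\<in>P. \<eta> a (\<delta> a)) (hom_U M)"
    proof (rule inj_onI)
      fix \<eta> \<theta> assume "\<eta> \<in> hom_U M" "\<theta> \<in> hom_U M"
        and eq: "(\<lambda>a\<in>P. \<eta> a (\<delta> a)) = (\<lambda>a\<in>P. \<theta> a (\<delta> a))"
      show "\<eta> = \<theta>"
      proof (rule HomU_eqI[OF M \<open>\<eta> \<in> hom_U M\<close> \<open>\<theta> \<in> hom_U M\<close>])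
        fix a assume "a \<in> P"
        then show "\<eta> a (\<delta> a) = \<theta> a (\<delta> a)" using fun_cong[OF eq, of a] by simp
      qed
    qed
  qed (simp add: hom_U_closed unit_vector_self)
  then show ?thesis
    using card_of_PiE_ordLess[OF finite_P \<kappa> small] by (rule ordLeq_ordLess_trans)
qed

lemma cat_functor_HomU:
  assumes \<kappa>: "Card_order \<kappa>" "infinite (Field \<kappa>)"
  shows "cat_functor (PMod \<kappa> P leq R) (Mod \<kappa> EndU) (Hom_functor P leq R U)"
proof (intro cat_functor.intro cat_functor_axioms.intro category_functor_cat category_Mod, goal_cases)
  case (1 M)
  then have "pers M" "\<And>b. b \<in> P \<Longrightarrow> |carrier (FObj M b)| <o \<kappa>"
    by (auto simp: PMod_Obj_iff[OF preorder])
  then show ?case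
    by (simp add: Mod_def Hom_functor_def right_module_HomU card_hom_U \<kappa>)
next
  case (2 M N \<phi>)
  then have M: "pers M" and N: "pers N" and \<phi>: "\<phi> \<in> pmod_hom P leq R M N"
    by (auto simp: PMod_Obj_iff[OF preorder] pmod_hom_eq_Hom[symmetric])
  have \<phi>b: "\<phi> b \<in> rmod_hom R (FObj M b) (FObj N b)" if "b \<in> P" for b
    using \<phi> that by (auto simp: pmod_hom_def)
  note cl = pmod_comp_hom_U[OF M N _ \<phi>]
  have "(\<lambda>\<eta>\<in>hom_U M. pmod_comp P U \<phi> \<eta>) \<in> rmod_hom EndU (HomU M) (HomU N)"
  proof (rule rmod_homI)
    fix \<eta> \<theta> assume *: "\<eta> \<in> carrier (HomU M)" "\<theta> \<in> carrier (HomU M)"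
    then have "pmod_comp P U \<phi> (\<eta> \<oplus>\<^bsub>HomU M\<^esub> \<theta>) =
        pmod_comp P U \<phi> \<eta> \<oplus>\<^bsub>HomU N\<^esub> pmod_comp P U \<phi> \<theta>"
      by (intro hom_U_ext[of _ N _ N])
        (auto simp: cl HomU_add_closed M N hom_U_closed rmod_hom_add[OF \<phi>b])
    then show "(\<lambda>\<eta>\<in>hom_U M. pmod_comp P U \<phi> \<eta>) (\<eta> \<oplus>\<^bsub>HomU M\<^esub> \<theta>) =
        (\<lambda>\<eta>\<in>hom_U M. pmod_comp P U \<phi> \<eta>) \<eta> \<oplus>\<^bsub>HomU N\<^esub> (\<lambda>\<eta>\<in>hom_U M. pmod_comp P U \<phi> \<eta>) \<theta>"
      using * by (simp add: HomU_add_closed M)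
  next
    fix \<eta> \<alpha> assume *: "\<eta> \<in> carrier (HomU M)" "\<alpha> \<in> carrier EndU"
    then have \<eta>\<alpha>: "pmod_comp P U \<eta> \<alpha> \<in> hom_U M"
      by (simp add: pmod_comp_hom_U[OF pers_U M])
    \<comment> \<open>Linearity over \<open>EndU\<close> is associativity of composition:
      \<open>\<phi>\<close> acts on the left, \<open>\<alpha>\<close> on the right.\<close>
    with * have "pmod_comp P U \<phi> (pmod_comp P U \<eta> \<alpha>) = pmod_comp P U (pmod_comp P U \<phi> \<eta>) \<alpha>"
      by (intro hom_U_ext[of _ N _ N]) (auto simp: cl pmod_comp_hom_U[OF pers_U N] hom_U_closed)
    then show "(\<lambda>\<eta>\<in>hom_U M. pmod_comp P U \<phi> \<eta>) (\<eta> \<star>\<^bsub>HomU M\<^esub> \<alpha>) =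
        (\<lambda>\<eta>\<in>hom_U M. pmod_comp P U \<phi> \<eta>) \<eta> \<star>\<^bsub>HomU N\<^esub> \<alpha>"
      using * \<eta>\<alpha> by simp
  qed (auto simp: cl)
  then show ?case by (simp add: Mod_def Hom_functor_def)
next
  case (3 M)
  then have M: "pers M" and "Ide (PMod \<kappa> P leq R) M \<in> pmod_hom P leq R M M"
    using category.Ide_Hom[OF category_functor_cat[OF category_Mod] 3]
    by (auto simp: PMod_Obj_iff[OF preorder] pmod_hom_eq_Hom[of _ _ _ _ _ \<kappa>])
  then have "pmod_comp P U (Ide (PMod \<kappa> P leq R) M) \<eta> = \<eta>" if "\<eta> \<in> hom_U M" for \<eta>
    using that by (intro hom_U_ext[of _ M _ M] pmod_comp_hom_U)
      (auto simp: functor_cat_def preorder_cat_def Mod_def hom_U_closed)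
  then show ?case
    by (auto simp: Hom_functor_def Mod_def intro!: restrict_ext)
next
  case (4 L M N \<phi> \<psi>)
  then have L: "pers L" and M: "pers M" and N: "pers N"
    and \<phi>: "\<phi> \<in> pmod_hom P leq R L M" and \<psi>: "\<psi> \<in> pmod_hom P leq R M N"
    and "Comp (PMod \<kappa> P leq R) L M N \<psi> \<phi> \<in> pmod_hom P leq R L N"
    using category.Comp_Hom[OF category_functor_cat[OF category_Mod] 4]
    by (auto simp: PMod_Obj_iff[OF preorder] pmod_hom_eq_Hom[symmetric])
  then have "pmod_comp P U (Comp (PMod \<kappa> P leq R) L M N \<psi> \<phi>) \<eta> =
      pmod_comp P U \<psi> (pmod_comp P U \<phi> \<eta>)" if "\<eta> \<in> hom_U L" for \<eta>
    using that pmod_comp_hom_U[OF L M that \<phi>]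
    by (intro hom_U_ext[of _ N _ N] pmod_comp_hom_U[OF L N] pmod_comp_hom_U[OF M N])
      (auto simp: functor_cat_def preorder_cat_def Mod_def hom_U_closed compose_eq)
  then show ?case
    using pmod_comp_hom_U[OF L M _ \<phi>]
    by (auto simp: Hom_functor_def Mod_def compose_def intro!: restrict_ext)
qed

lemma HomU_ess_surj:
  fixes \<kappa> :: "'m rel"
  assumes \<kappa>: "Card_order \<kappa>" "infinite (Field \<kappa>)"
    and N: "N \<in> Obj (Mod \<kappa> EndU :: (_, 'n \<Rightarrow> 'n) cat)"
  shows "\<exists>M \<in> Obj (PMod \<kappa> P leq R :: (('p, 'r, 'm) pmodule, _) cat).
    \<exists>f. f \<in> rmod_hom EndU N (HomU M) \<and> bij_betw f (carrier N) (carrier (HomU M))"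
proof -
  have Nm: "right_module EndU N" and small: "|carrier N| <o \<kappa>"
    using N by (auto simp: Mod_def)
  \<comment> \<open>Since \<open>\<kappa>\<close> is a relation on \<open>'m\<close>, smallness of
    \<open>N\<close> provides an injection of its carrier into \<open>'m\<close>, the element type
    required of the persistence module.\<close>
  have "|carrier N| \<le>o |Field \<kappa>|"
    using small \<kappa>(1) card_of_Field_ordIso ordIso_symmetric ordLess_imp_ordLeq ordLeq_ordIso_trans
    by blast
  then obtain j :: "'n \<Rightarrow> 'm" where j: "inj_on j (carrier N)"
    by (auto simp: card_of_ordLeq[symmetric])
  let ?M = "pmod_image j (corner N)"
  have "|carrier (FObj ?M b)| <o \<kappa>" for b
  proof -
    have "|carrier (FObj (corner N) b)| \<le>o |carrier N|" by (rule card_of_mono1) auto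
    moreover have "|j ` carrier (FObj (corner N) b)| \<le>o |carrier (FObj (corner N) b)|"
      by (rule card_of_image)
    ultimately show ?thesis
      using small ordLeq_ordLess_trans by (metis FObj_pmod_image rmodule_image_simps(1))
  qed
  then have "?M \<in> Obj (PMod \<kappa> P leq R)"
    using Nm j by (simp add: PMod_Obj_iff[OF preorder] pers_module_image pers_corner inj_on_corner)
  then show ?thesis
    using corner_hom_rmod_hom[OF Nm j] corner_hom_bij[OF Nm j] by blast
qed

end

section \<open>\<open>Hom(U, -)\<close> as an equivalence of categories\<close>

theorem theorem9p7:
  fixes P :: "'p set" and leq :: "'p rel" and R :: "('r, 'x) ring_scheme"
    and \<kappa> :: "'m rel" and U :: "('p, 'r, 'p \<Rightarrow> 'r) pmodule"
  assumes "finite P" and "preorder_on P leq"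
    and "ring R"
    and "Card_order \<kappa>" and "infinite (Field \<kappa>)"
  defines "U \<equiv> pmod_dsum P (\<lambda>a. indicator_pmod R (up_set P leq a))"
  shows "equivalence_of_categories
           (PMod \<kappa> P leq R :: (('p, 'r, 'm) pmodule, 'p \<Rightarrow> 'm \<Rightarrow> 'm) cat)
           (Mod \<kappa> (End_ring P leq R U))
           (Hom_functor P leq R U)"
proof -
  interpret S: finite_preorder_ring P leq R
    using assms by (simp add: finite_preorder_ring_def finite_preorder_ring_axioms_def)
  have U: "U = S.U" by (simp add: U_def S.U_def)
  note obj = PMod_Obj_iff[OF assms(2)]
  show ?thesis
    unfolding U
  proof (rule equivalence_of_categoriesI[OF S.cat_functor_HomU[OF assms(4,5)]])
    fix M N :: "('p, 'r, 'm) pmodule" and \<phi> \<psi>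
    assume MN: "M \<in> Obj (PMod \<kappa> P leq R)" "N \<in> Obj (PMod \<kappa> P leq R)"
      and h: "\<phi> \<in> Hom (PMod \<kappa> P leq R) M N" "\<psi> \<in> Hom (PMod \<kappa> P leq R) M N"
      and eq: "FArr (Hom_functor P leq R S.U) M N \<phi> = FArr (Hom_functor P leq R S.U) M N \<psi>"
    show "\<phi> = \<psi>"
    proof (rule S.HomU_faithful)
      fix \<eta> assume "\<eta> \<in> pmod_hom P leq R S.U M"
      then show "pmod_comp P S.U \<phi> \<eta> = pmod_comp P S.U \<psi> \<eta>"
        using fun_cong[OF eq, of \<eta>] by (simp add: Hom_functor_def)
    qed (use MN h in \<open>auto simp: obj pmod_hom_eq_Hom[symmetric]\<close>)
  next
    fix M N :: "('p, 'r, 'm) pmodule" and h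
    assume MN: "M \<in> Obj (PMod \<kappa> P leq R)" "N \<in> Obj (PMod \<kappa> P leq R)"
      and h: "h \<in> Hom (Mod \<kappa> (End_ring P leq R S.U))
        (FObj (Hom_functor P leq R S.U) M) (FObj (Hom_functor P leq R S.U) N)"
    from h have h': "h \<in> rmod_hom (End_ring P leq R S.U)
        (Hom_rmodule P leq R S.U M) (Hom_rmodule P leq R S.U N)"
      by (simp add: Mod_def Hom_functor_def)
    then obtain \<phi> where \<phi>: "\<phi> \<in> pmod_hom P leq R M N"
      "\<And>\<eta>. \<eta> \<in> pmod_hom P leq R S.U M \<Longrightarrow> pmod_comp P S.U \<phi> \<eta> = h \<eta>"
      using S.HomU_full[of M N h] MN by (auto simp: obj)
    have "FArr (Hom_functor P leq R S.U) M N \<phi> = h"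
      \<comment> \<open>Both functions are extensional on \<open>Hom(U, M)\<close>, so their
        agreement there makes them equal.\<close>
      using rmod_hom_extensional[OF h']
      by (intro extensionalityI[where A = "pmod_hom P leq R S.U M"])
        (auto simp: Hom_functor_def \<phi>)
    with \<phi>(1) show "\<exists>\<phi> \<in> Hom (PMod \<kappa> P leq R) M N. FArr (Hom_functor P leq R S.U) M N \<phi> = h"
      by (auto simp: pmod_hom_eq_Hom[of _ _ _ _ _ \<kappa>])
  next
    fix N :: "('p \<Rightarrow> ('p \<Rightarrow> 'r) \<Rightarrow> 'p \<Rightarrow> 'r, 'p \<Rightarrow> ('p \<Rightarrow> 'r) \<Rightarrow> 'm) rmodule"
    assume N: "N \<in> Obj (Mod \<kappa> (End_ring P leq R S.U))"
    obtain M :: "('p, 'r, 'm) pmodule" and f where M: "M \<in> Obj (PMod \<kappa> P leq R)"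
      and "f \<in> rmod_hom (End_ring P leq R S.U) N (Hom_rmodule P leq R S.U M)"
      "bij_betw f (carrier N) (carrier (Hom_rmodule P leq R S.U M))"
      using S.HomU_ess_surj[OF assms(4,5) N] by blast
    then have "iso_in (Mod \<kappa> (End_ring P leq R S.U)) N (Hom_rmodule P leq R S.U M) f"
      using N by (intro iso_in_Mod) (auto simp: Mod_def)
    \<comment> \<open>The constructed isomorphism starts at \<open>N\<close>, whereas essential
      surjectivity asks for one that ends there.\<close>
    from iso_in_sym[OF this] M
    show "\<exists>M \<in> Obj (PMod \<kappa> P leq R). \<exists>e.
        iso_in (Mod \<kappa> (End_ring P leq R S.U)) (FObj (Hom_functor P leq R S.U) M) N e"
      by (auto simp: Hom_functor_def)
  qed
qed

end
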